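(* Let $\mathcal{S}_1\xrightarrow{\phi_1}\mathcal{S}_2\xrightarrow{\phi_2}\mathcal{S}_3\xrightarrow{\phi_3}\cdots$ be an inductive system in the category $\mathbf{OS}$ of operator systems and unital completely positive maps such that each $\phi_k$ is a complete order isomorphism onto its image. Let $\mathcal{T}$ be an operator system and let $\mu$ be a functorial, injective operator system tensor product. Then the map $\widetilde\alpha:(\varinjlim_{\mathbf{OS}}\mathcal{S}_k)\otimes_\mu\mathcal{T}\to\varinjlim_{\mathbf{OS}}(\mathcal{S}_k\otimes_\mu\mathcal{T})$ determined by $\widetilde\alpha\circ(\phi_{k,\infty}\otimes\mathrm{id}_{\mathcal{T}})=\psi_{k,\infty}$, $k\in\mathbb{N}$, is a unital complete order isomorphism.
   Context: An operator system (not assumed complete) is a matrix ordered $*$-vector space with an Archimedean matrix order unit. Inductive limits in $\mathbf{OS}$ (objects with compatible unital completely positive maps, universal with this property) exist and are unique up to unital complete order isomorphism. $\phi_{k,\infty}:\mathcal{S}_k\to\varinjlim_{\mathbf{OS}}\mathcal{S}_k$ denotes the canonical map, and $\psi_{k,\infty}:\mathcal{S}_k\otimes_\mu\mathcal{T}\to\varinjlim_{\mathbf{OS}}(\mathcal{S}_k\otimes_\mu\mathcal{T})$ the canonical map for the system $\mathcal{S}_1\otimes_\mu\mathcal{T}\xrightarrow{\phi_1\otimes\mathrm{id}_{\mathcal{T}}}\mathcal{S}_2\otimes_\mu\mathcal{T}\xrightarrow{\phi_2\otimes\mathrm{id}_{\mathcal{T}}}\cdots$. The map $\widetilde\alpha$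 in the claim is a well-defined linear bijection. $\odot$ is the algebraic tensor product. An operator system structure on $\mathcal{S}\odot\mathcal{T}$ is a family of cones $P_n\subseteq M_n(\mathcal{S}\odot\mathcal{T})$ such that (i) $(\mathcal{S}\odot\mathcal{T},\{P_n\},e_{\mathcal{S}}\otimes e_{\mathcal{T}})$ is an operator system; (ii) $M_n(\mathcal{S})^+\otimes M_m(\mathcal{T})^+\subseteq P_{nm}$ for all $n,m$; (iii) for all unital completely positive $\phi:\mathcal{S}\to M_n$, $\psi:\mathcal{T}\to M_m$, the map $\phi\otimes\psi$ is completely positive from $(\mathcal{S}\odot\mathcal{T},\{P_n\})$ to $M_{nm}$. An operator system tensor product $\mu$ assigns to each pair $(\mathcal{S},\mathcal{T})$ such a structure, giving an operator system $\mathcal{S}\otimes_\mu\mathcal{T}$. It is functorial if $\phi_1\otimes\phi_2:\mathcal{S}_1\otimes_\mu\mathcal{S}_2\to\mathcal{T}_1\otimes_\mu\mathcal{T}_2$ is unital completely positive whenever $\phi_1,\phi_2$ are unital completely positive, and injective if $\phi_1\otimes\phi_2$ is a unital complete order embedding whenever $\phi_1,\phi_2$ are unital complete order embeddings. A (unital) complete order embedding is a (unital) complete order isomorphism onto its image; a complete order isomorphism is a linear bijection, completely positive with completely positive inverse. *)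

theory Defs
  imports "Jordan_Normal_Form.Schur_Decomposition"
begin

hide_const (open) Multiset.mult Polynomial.smult Modules.module_hom

section \<open>Operator systems\<close>

text \<open>
  The record extends the HOL-Algebra record of modules over the field of complex numbers
  (\<^const>\<open>class_ring\<close>). Its inherited fields \<^const>\<open>mult\<close> and \<^const>\<open>one\<close> play no role. The
  elements of \<open>pos S n\<close> are the positive elements of the \<open>n \<times> n\<close> matrices over \<open>S\<close>;
  matrices are those of \<open>Jordan_Normal_Form\<close>, used as containers for entries in a carrier.
  Only matrix sizes \<open>n \<ge> 1\<close> are meaningful: \<open>pos S 0\<close> is ignored throughout.
\<close>

record 'a opsys = "(complex, 'a) module" +
  adj :: "'a \<Rightarrow> 'a"
  order_unit :: 'a
  pos :: "nat \<Rightarrow> 'a mat set"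

definition mats :: "'a opsys \<Rightarrow> nat \<Rightarrow> 'a mat set" where
  "mats S n = {X \<in> carrier_mat n n. \<forall>i<n. \<forall>j<n. X $$ (i, j) \<in> carrier S}"

definition mats_zero :: "'a opsys \<Rightarrow> nat \<Rightarrow> 'a mat" where
  "mats_zero S n = mat n n (\<lambda>_. \<zero>\<^bsub>S\<^esub>)"

definition mats_add :: "'a opsys \<Rightarrow> 'a mat \<Rightarrow> 'a mat \<Rightarrow> 'a mat" where
  "mats_add S X Y = mat (dim_row X) (dim_col X) (\<lambda>ij. X $$ ij \<oplus>\<^bsub>S\<^esub> Y $$ ij)"

definition mats_smult :: "'a opsys \<Rightarrow> complex \<Rightarrow> 'a mat \<Rightarrow> 'a mat" where
  "mats_smult S c X = map_mat (\<lambda>x. c \<odot>\<^bsub>S\<^esub> x) X"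

definition mats_adj :: "'a opsys \<Rightarrow> 'a mat \<Rightarrow> 'a mat" where
  "mats_adj S X = mat (dim_col X) (dim_row X) (\<lambda>(i, j). adj S (X $$ (j, i)))"

definition herm :: "'a opsys \<Rightarrow> nat \<Rightarrow> 'a mat set" where
  "herm S n = {X \<in> mats S n. mats_adj S X = X}"

definition mats_unit :: "'a opsys \<Rightarrow> nat \<Rightarrow> 'a mat" where
  "mats_unit S n = mat n n (\<lambda>(i, j). if i = j then order_unit S else \<zero>\<^bsub>S\<^esub>)"

text \<open>The compression \<open>A\<^sup>* X A\<close> of an \<open>n \<times> n\<close> matrix \<open>X\<close> over \<open>S\<close> by a complex
  \<open>n \<times> m\<close> matrix \<open>A\<close>.\<close>

definition mats_compress :: "'a opsys \<Rightarrow> complex mat \<Rightarrow> 'a mat \<Rightarrow> 'a mat" where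
  "mats_compress S A X = mat (dim_col A) (dim_col A) (\<lambda>(i, j).
     \<Oplus>\<^bsub>S\<^esub>k\<in>{..<dim_row A}. \<Oplus>\<^bsub>S\<^esub>l\<in>{..<dim_row A}.
       (cnj (A $$ (k, i)) * A $$ (l, j)) \<odot>\<^bsub>S\<^esub> X $$ (k, l))"

locale star_vector_space = vectorspace "class_ring :: complex ring" S
  for S :: "'a opsys" (structure) +
  assumes adj_closed: "x \<in> carrier S \<Longrightarrow> adj S x \<in> carrier S"
    and adj_adj: "x \<in> carrier S \<Longrightarrow> adj S (adj S x) = x"
    and adj_add: "x \<in> carrier S \<Longrightarrow> y \<in> carrier S \<Longrightarrow> adj S (x \<oplus> y) = adj S x \<oplus> adj S y"
    and adj_smult: "x \<in> carrier S \<Longrightarrow> adj S (c \<odot>\<^bsub>S\<^esub> x) = cnj c \<odot>\<^bsub>S\<^esub> adj S x"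

locale matrix_ordered_space = star_vector_space +
  assumes pos_herm: "n \<ge> 1 \<Longrightarrow> pos S n \<subseteq> herm S n"
    and pos_zero: "n \<ge> 1 \<Longrightarrow> mats_zero S n \<in> pos S n"
    and pos_add: "n \<ge> 1 \<Longrightarrow> X \<in> pos S n \<Longrightarrow> Y \<in> pos S n \<Longrightarrow> mats_add S X Y \<in> pos S n"
    and pos_smult: "n \<ge> 1 \<Longrightarrow> X \<in> pos S n \<Longrightarrow> (r::real) \<ge> 0 \<Longrightarrow>
          mats_smult S (complex_of_real r) X \<in> pos S n"
    and pos_proper: "n \<ge> 1 \<Longrightarrow> X \<in> pos S n \<Longrightarrow> mats_smult S (-1) X \<in> pos S n \<Longrightarrow>
          X = mats_zero S n"
    and pos_compress: "n \<ge> 1 \<Longrightarrow> m \<ge> 1 \<Longrightarrow> A \<in> carrier_mat n m \<Longrightarrow> X \<in> pos S n \<Longrightarrow>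
          mats_compress S A X \<in> pos S m"

locale operator_system = matrix_ordered_space +
  assumes order_unit_closed: "order_unit S \<in> carrier S"
    and order_unit_adj: "adj S (order_unit S) = order_unit S"
    and matrix_order_unit: "n \<ge> 1 \<Longrightarrow> X \<in> herm S n \<Longrightarrow>
          \<exists>r::real. r > 0 \<and>
            mats_add S (mats_smult S (complex_of_real r) (mats_unit S n)) (mats_smult S (-1) X)
              \<in> pos S n"
    and archimedean: "n \<ge> 1 \<Longrightarrow> X \<in> herm S n \<Longrightarrow>
          (\<And>r::real. r > 0 \<Longrightarrow>
             mats_add S (mats_smult S (complex_of_real r) (mats_unit S n)) X \<in> pos S n) \<Longrightarrow>
          X \<in> pos S n"

definition linear_maps :: "'a opsys \<Rightarrow> 'b opsys \<Rightarrow> ('a \<Rightarrow> 'b) set" where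
  "linear_maps S T = module_hom (class_ring :: complex ring) S T"

definition completely_positive :: "'a opsys \<Rightarrow> 'b opsys \<Rightarrow> ('a \<Rightarrow> 'b) \<Rightarrow> bool" where
  "completely_positive S T f \<longleftrightarrow>
     f \<in> linear_maps S T \<and> (\<forall>n\<ge>1. \<forall>X\<in>pos S n. map_mat f X \<in> pos T n)"

definition unital :: "'a opsys \<Rightarrow> 'b opsys \<Rightarrow> ('a \<Rightarrow> 'b) \<Rightarrow> bool" where
  "unital S T f \<longleftrightarrow> f (order_unit S) = order_unit T"

definition ucp :: "'a opsys \<Rightarrow> 'b opsys \<Rightarrow> ('a \<Rightarrow> 'b) \<Rightarrow> bool" where
  "ucp S T f \<longleftrightarrow> unital S T f \<and> completely_positive S T f"

definition complete_order_iso :: "'a opsys \<Rightarrow> 'b opsys \<Rightarrow> ('a \<Rightarrow> 'b) \<Rightarrow> bool" where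
  "complete_order_iso S T f \<longleftrightarrow>
     bij_betw f (carrier S) (carrier T) \<and> completely_positive S T f \<and>
     completely_positive T S (inv_into (carrier S) f)"

text \<open>A linear subspace with the inherited matrix order. The order unit of \<open>T\<close> is kept, whether
  or not it lies in the subspace; it has no bearing on \<^const>\<open>complete_order_iso\<close>.\<close>

definition restrict_opsys :: "'a opsys \<Rightarrow> 'a set \<Rightarrow> 'a opsys" where
  "restrict_opsys T V = T\<lparr>carrier := V,
     pos := (\<lambda>n. {X \<in> pos T n. \<forall>i<n. \<forall>j<n. X $$ (i, j) \<in> V})\<rparr>"

definition complete_order_embedding :: "'a opsys \<Rightarrow> 'b opsys \<Rightarrow> ('a \<Rightarrow> 'b) \<Rightarrow> bool" where
  "complete_order_embedding S T f \<longleftrightarrow>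
     f \<in> carrier S \<rightarrow> carrier T \<and> complete_order_iso S (restrict_opsys T (f ` carrier S)) f"


section \<open>Inductive limits\<close>

definition inductive_system :: "(nat \<Rightarrow> 'a opsys) \<Rightarrow> (nat \<Rightarrow> 'a \<Rightarrow> 'a) \<Rightarrow> bool" where
  "inductive_system S f \<longleftrightarrow>
     (\<forall>k. operator_system (S k)) \<and> (\<forall>k. ucp (S k) (S (Suc k)) (f k))"

definition compatible_maps ::
  "(nat \<Rightarrow> 'a opsys) \<Rightarrow> (nat \<Rightarrow> 'a \<Rightarrow> 'a) \<Rightarrow> 'b opsys \<Rightarrow> (nat \<Rightarrow> 'a \<Rightarrow> 'b) \<Rightarrow> bool" where
  "compatible_maps S f R \<rho> \<longleftrightarrow>
     operator_system R \<and> (\<forall>k. ucp (S k) R (\<rho> k)) \<and>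
     (\<forall>k. \<forall>x\<in>carrier (S k). \<rho> (Suc k) (f k x) = \<rho> k x)"

text \<open>
  The universal property refers to all operator systems \<open>R\<close> carried by subsets of the type in
  which the \<open>S k\<close> and \<open>L\<close> live. This is no restriction: a nonzero operator system
  has an infinite carrier, and a limit of a sequence of operator systems of cardinality at most
  that of the type can again be realised on a subset of the type, so the property below
  characterises the limit in the category of all operator systems.
\<close>

definition inductive_limit ::
  "(nat \<Rightarrow> 'a opsys) \<Rightarrow> (nat \<Rightarrow> 'a \<Rightarrow> 'a) \<Rightarrow> 'a opsys \<Rightarrow> (nat \<Rightarrow> 'a \<Rightarrow> 'a) \<Rightarrow> bool" where
  "inductive_limit S f L f_inf \<longleftrightarrow>
     compatible_maps S f L f_inf \<and>
     (\<forall>(R :: 'a opsys) \<rho>. compatible_maps S f R \<rho> \<longrightarrow>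
        (\<exists>\<theta>. ucp L R \<theta> \<and> (\<forall>k. \<forall>x\<in>carrier (S k). \<theta> (f_inf k x) = \<rho> k x) \<and>
           (\<forall>\<theta>'. ucp L R \<theta>' \<and> (\<forall>k. \<forall>x\<in>carrier (S k). \<theta>' (f_inf k x) = \<rho> k x) \<longrightarrow>
              (\<forall>y\<in>carrier L. \<theta>' y = \<theta> y))))"


section \<open>The algebraic tensor product\<close>

text \<open>
  The algebraic tensor product of \<open>S\<close> and \<open>T\<close> is realised inside the dual of the space of
  bilinear forms on \<open>S \<times> T\<close>: the elementary tensor of \<open>s\<close> and \<open>t\<close> is evaluation at
  \<open>(s, t)\<close>, and the tensor product is the linear span of the elementary tensors. Functionals
  are extended by \<open>0\<close> to arguments that are not bilinear forms.
\<close>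

type_synonym ('a, 'b) tensor = "('a \<Rightarrow> 'b \<Rightarrow> complex) \<Rightarrow> complex"

definition bilinear_forms :: "'a opsys \<Rightarrow> 'b opsys \<Rightarrow> ('a \<Rightarrow> 'b \<Rightarrow> complex) set" where
  "bilinear_forms S T = {B.
     (\<forall>s\<in>carrier S. \<forall>s'\<in>carrier S. \<forall>t\<in>carrier T. B (s \<oplus>\<^bsub>S\<^esub> s') t = B s t + B s' t) \<and>
     (\<forall>c. \<forall>s\<in>carrier S. \<forall>t\<in>carrier T. B (c \<odot>\<^bsub>S\<^esub> s) t = c * B s t) \<and>
     (\<forall>s\<in>carrier S. \<forall>t\<in>carrier T. \<forall>t'\<in>carrier T. B s (t \<oplus>\<^bsub>T\<^esub> t') = B s t + B s t') \<and>
     (\<forall>c. \<forall>s\<in>carrier S. \<forall>t\<in>carrier T. B s (c \<odot>\<^bsub>T\<^esub> t) = c * B s t)}"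

definition tensor :: "'a opsys \<Rightarrow> 'b opsys \<Rightarrow> 'a \<Rightarrow> 'b \<Rightarrow> ('a, 'b) tensor" where
  "tensor S T s t = (\<lambda>B. if B \<in> bilinear_forms S T then B s t else 0)"

definition tensor_carrier :: "'a opsys \<Rightarrow> 'b opsys \<Rightarrow> ('a, 'b) tensor set" where
  "tensor_carrier S T = {(\<lambda>B. \<Sum>i<n. tensor S T (s i) (t i) B) | (n::nat) s t.
     (\<forall>i<n. s i \<in> carrier S) \<and> (\<forall>i<n. t i \<in> carrier T)}"

text \<open>The involution with \<open>(s \<otimes> t)\<^sup>* = s\<^sup>* \<otimes> t\<^sup>*\<close>.\<close>

definition tensor_adj :: "'a opsys \<Rightarrow> 'b opsys \<Rightarrow> ('a, 'b) tensor \<Rightarrow> ('a, 'b) tensor" where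
  "tensor_adj S T u = (\<lambda>B. if B \<in> bilinear_forms S T
     then cnj (u (\<lambda>s t. cnj (B (adj S s) (adj T t)))) else 0)"

text \<open>The algebraic tensor product with matrix cones \<open>P\<close>.\<close>

definition tensor_opsys ::
  "'a opsys \<Rightarrow> 'b opsys \<Rightarrow> (nat \<Rightarrow> ('a, 'b) tensor mat set) \<Rightarrow> ('a, 'b) tensor opsys" where
  "tensor_opsys S T P = \<lparr>
     carrier = tensor_carrier S T,
     mult = undefined,
     one = undefined,
     zero = (\<lambda>B. 0),
     add = (\<lambda>u v B. u B + v B),
     smult = (\<lambda>c u B. c * u B),
     adj = tensor_adj S T,
     order_unit = tensor S T (order_unit S) (order_unit T),
     pos = P\<rparr>"

text \<open>For linear \<open>f\<close>, \<open>g\<close> with codomains \<open>S'\<close>, \<open>T'\<close>, the linear map \<open>f \<otimes> g\<close>: on elementary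
  tensors it sends \<open>s \<otimes> t\<close> to \<open>f s \<otimes> g t\<close>.\<close>

definition tensor_map ::
  "'c opsys \<Rightarrow> 'd opsys \<Rightarrow> ('a \<Rightarrow> 'c) \<Rightarrow> ('b \<Rightarrow> 'd) \<Rightarrow> ('a, 'b) tensor \<Rightarrow> ('c, 'd) tensor" where
  "tensor_map S' T' f g u = (\<lambda>B. if B \<in> bilinear_forms S' T'
     then u (\<lambda>s t. B (f s) (g t)) else 0)"

definition kronecker :: "('a \<Rightarrow> 'b \<Rightarrow> 'c) \<Rightarrow> 'a mat \<Rightarrow> 'b mat \<Rightarrow> 'c mat" where
  "kronecker p X Y = mat (dim_row X * dim_row Y) (dim_col X * dim_col Y) (\<lambda>(i, j).
     p (X $$ (i div dim_row Y, j div dim_col Y)) (Y $$ (i mod dim_row Y, j mod dim_col Y)))"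


section \<open>Operator system tensor products\<close>

definition psd :: "nat \<Rightarrow> complex mat \<Rightarrow> bool" where
  "psd n A \<longleftrightarrow> A \<in> carrier_mat n n \<and> (\<forall>v\<in>carrier_vec n. 0 \<le> (A *\<^sub>v v) \<bullet>c v)"

text \<open>The operator system of complex \<open>n \<times> n\<close> matrices; an \<open>m \<times> m\<close> matrix with entries in it is
  positive if the \<open>mn \<times> mn\<close> matrix with these blocks is positive semidefinite.\<close>

definition flatten_blocks :: "nat \<Rightarrow> nat \<Rightarrow> complex mat mat \<Rightarrow> complex mat" where
  "flatten_blocks m n X = mat (m * n) (m * n) (\<lambda>(i, j).
     X $$ (i div n, j div n) $$ (i mod n, j mod n))"

definition matrix_opsys :: "nat \<Rightarrow> complex mat opsys" where
  "matrix_opsys n = module.extend (module_mat TYPE(complex) n n) \<lparr>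
     adj = mat_adjoint,
     order_unit = 1\<^sub>m n,
     pos = (\<lambda>m. {X \<in> carrier_mat m m.
        (\<forall>i<m. \<forall>j<m. X $$ (i, j) \<in> carrier_mat n n) \<and> psd (m * n) (flatten_blocks m n X)})\<rparr>"

text \<open>For linear \<open>f\<close>, \<open>g\<close> with values in the \<open>n \<times> n\<close> and \<open>m \<times> m\<close> matrices, the
  linear map \<open>f \<otimes> g\<close> into the \<open>nm \<times> nm\<close> matrices: on elementary tensors it sends
  \<open>s \<otimes> t\<close> to the Kronecker product of \<open>f s\<close> and \<open>g t\<close>.\<close>

definition tensor_map_matrix ::
  "nat \<Rightarrow> nat \<Rightarrow> ('a \<Rightarrow> complex mat) \<Rightarrow> ('b \<Rightarrow> complex mat) \<Rightarrow> ('a, 'b) tensor \<Rightarrow> complex mat" where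
  "tensor_map_matrix n m f g u = mat (n * m) (n * m) (\<lambda>ij.
     u (\<lambda>s t. kronecker (*) (f s) (g t) $$ ij))"

definition tensor_structure ::
  "'a opsys \<Rightarrow> 'b opsys \<Rightarrow> (nat \<Rightarrow> ('a, 'b) tensor mat set) \<Rightarrow> bool" where
  "tensor_structure S T P \<longleftrightarrow>
     operator_system (tensor_opsys S T P) \<and>
     (\<forall>n\<ge>1. \<forall>m\<ge>1. \<forall>X\<in>pos S n. \<forall>Y\<in>pos T m. kronecker (tensor S T) X Y \<in> P (n * m)) \<and>
     (\<forall>n\<ge>1. \<forall>m\<ge>1. \<forall>f g. ucp S (matrix_opsys n) f \<and> ucp T (matrix_opsys m) g \<longrightarrow>
        completely_positive (tensor_opsys S T P) (matrix_opsys (n * m))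
          (tensor_map_matrix n m f g))"

type_synonym 'a tensor_cones = "'a opsys \<Rightarrow> 'a opsys \<Rightarrow> nat \<Rightarrow> ('a, 'a) tensor mat set"

abbreviation opsys_tensor ::
  "'a opsys \<Rightarrow> 'a tensor_cones \<Rightarrow> 'a opsys \<Rightarrow> ('a, 'a) tensor opsys"
  ("_ \<otimes>[_] _" [71, 0, 71] 70) where
  "S \<otimes>[\<mu>] T \<equiv> tensor_opsys S T (\<mu> S T)"

definition operator_system_tensor_product :: "'a tensor_cones \<Rightarrow> bool" where
  "operator_system_tensor_product \<mu> \<longleftrightarrow>
     (\<forall>S T. operator_system S \<and> operator_system T \<longrightarrow> tensor_structure S T (\<mu> S T))"

definition functorial_tensor_product :: "'a tensor_cones \<Rightarrow> bool" where
  "functorial_tensor_product \<mu> \<longleftrightarrow> (\<forall>S\<^sub>1 S\<^sub>2 T\<^sub>1 T\<^sub>2 f\<^sub>1 f\<^sub>2.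
     operator_system S\<^sub>1 \<and> operator_system S\<^sub>2 \<and> operator_system T\<^sub>1 \<and> operator_system T\<^sub>2 \<and>
     ucp S\<^sub>1 T\<^sub>1 f\<^sub>1 \<and> ucp S\<^sub>2 T\<^sub>2 f\<^sub>2 \<longrightarrow>
     ucp (S\<^sub>1 \<otimes>[\<mu>] S\<^sub>2) (T\<^sub>1 \<otimes>[\<mu>] T\<^sub>2) (tensor_map T\<^sub>1 T\<^sub>2 f\<^sub>1 f\<^sub>2))"

definition injective_tensor_product :: "'a tensor_cones \<Rightarrow> bool" where
  "injective_tensor_product \<mu> \<longleftrightarrow> (\<forall>S\<^sub>1 S\<^sub>2 T\<^sub>1 T\<^sub>2 f\<^sub>1 f\<^sub>2.
     operator_system S\<^sub>1 \<and> operator_system S\<^sub>2 \<and> operator_system T\<^sub>1 \<and> operator_system T\<^sub>2 \<and>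
     unital S\<^sub>1 T\<^sub>1 f\<^sub>1 \<and> complete_order_embedding S\<^sub>1 T\<^sub>1 f\<^sub>1 \<and>
     unital S\<^sub>2 T\<^sub>2 f\<^sub>2 \<and> complete_order_embedding S\<^sub>2 T\<^sub>2 f\<^sub>2 \<longrightarrow>
     unital (S\<^sub>1 \<otimes>[\<mu>] S\<^sub>2) (T\<^sub>1 \<otimes>[\<mu>] T\<^sub>2) (tensor_map T\<^sub>1 T\<^sub>2 f\<^sub>1 f\<^sub>2) \<and>
     complete_order_embedding (S\<^sub>1 \<otimes>[\<mu>] S\<^sub>2) (T\<^sub>1 \<otimes>[\<mu>] T\<^sub>2) (tensor_map T\<^sub>1 T\<^sub>2 f\<^sub>1 f\<^sub>2))"

end

theory Submission
  imports Defs
begin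

text \<open>
  When the connecting maps are complete order embeddings, the union of the \<open>S k\<close>, with the
  union of the cones, is already an operator system: a matrix over the union lives at some level
  \<open>k\<close>, and since positivity is the same at all levels, properness and the Archimedean property
  are inherited from \<open>S k\<close>. Comparing any inductive limit \<open>L\<close> with this union through the
  universal property shows that \<open>L\<close> is covered by the images of the canonical maps and that
  these are complete order embeddings.

  Injectivity of \<open>\<mu>\<close> makes the \<open>\<phi>\<^sub>k \<otimes> id\<close> and the \<open>\<phi>\<^bsub>k,\<infinity>\<^esub> \<otimes> id\<close> complete order embeddings, and
  the ranges of the latter cover \<open>L \<otimes> T\<close>, a tensor having only finitely many terms. The universal
  property of \<open>W\<close> yields a unital completely positive map \<open>\<theta> : W \<rightarrow> L \<otimes> T\<close>, a bijection. A positive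
  matrix over \<open>L \<otimes> T\<close> comes from a positive matrix at some level \<open>k\<close>, so \<open>\<alpha> = \<theta>\<^sup>-\<^sup>1\<close> is completely
  positive as well.
\<close>

subsection \<open>Linear maps and matrices\<close>

context star_vector_space
begin

lemma scale_closed: "x \<in> carrier S \<Longrightarrow> c \<odot>\<^bsub>S\<^esub> x \<in> carrier S"
  by (rule smult_closed) (simp_all add: class_ring_simps)

lemma scale_add_left: "x \<in> carrier S \<Longrightarrow> (c + d) \<odot>\<^bsub>S\<^esub> x = c \<odot>\<^bsub>S\<^esub> x \<oplus> d \<odot>\<^bsub>S\<^esub> x"
  using smult_l_distr[of c d x] by (simp add: class_ring_simps)

lemma scale_add_right:
  "x \<in> carrier S \<Longrightarrow> y \<in> carrier S \<Longrightarrow> c \<odot>\<^bsub>S\<^esub> (x \<oplus> y) = c \<odot>\<^bsub>S\<^esub> x \<oplus> c \<odot>\<^bsub>S\<^esub> y"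
  using smult_r_distr[of c x y] by (simp add: class_ring_simps)

lemma scale_scale: "x \<in> carrier S \<Longrightarrow> c \<odot>\<^bsub>S\<^esub> (d \<odot>\<^bsub>S\<^esub> x) = (c * d) \<odot>\<^bsub>S\<^esub> x"
  using smult_assoc1[of c d x] by (simp add: class_ring_simps)

lemma scale_one: "x \<in> carrier S \<Longrightarrow> 1 \<odot>\<^bsub>S\<^esub> x = x"
  using smult_one[of x] by (simp add: class_ring_simps)

lemma scale_zero_left: "x \<in> carrier S \<Longrightarrow> 0 \<odot>\<^bsub>S\<^esub> x = \<zero>"
  using smult_l_null[of x] by (simp add: class_ring_simps)

lemma scale_zero_right: "c \<odot>\<^bsub>S\<^esub> \<zero> = \<zero>"
  using smult_r_null[of c] by (simp add: class_ring_simps)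

lemma scale_cancel:
  assumes "c \<noteq> 0" "x \<in> carrier S" "y \<in> carrier S" "c \<odot>\<^bsub>S\<^esub> x = c \<odot>\<^bsub>S\<^esub> y"
  shows "x = y"
proof -
  have "inverse c \<odot>\<^bsub>S\<^esub> (c \<odot>\<^bsub>S\<^esub> x) = inverse c \<odot>\<^bsub>S\<^esub> (c \<odot>\<^bsub>S\<^esub> y)"
    using assms(4) by simp
  then show ?thesis using assms(1-3) by (simp add: scale_scale scale_one)
qed

lemma scale_left_inj:
  assumes x: "x \<in> carrier S" "x \<noteq> \<zero>" and eq: "c \<odot>\<^bsub>S\<^esub> x = d \<odot>\<^bsub>S\<^esub> x"
  shows "c = d"
proof (rule ccontr)
  assume "c \<noteq> d"
  have "(c - d) \<odot>\<^bsub>S\<^esub> x = \<zero>"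
    using x eq scale_add_left[of x c "- d"] scale_add_left[of x d "- d"]
    by (simp add: scale_zero_left)
  then have "(c - d) \<odot>\<^bsub>S\<^esub> x = (c - d) \<odot>\<^bsub>S\<^esub> \<zero>"
    by (simp add: scale_zero_right)
  from scale_cancel[OF _ x(1) _ this] \<open>c \<noteq> d\<close> x(2) show False by simp
qed

text \<open>The scalar multiples of a nonzero vector form a copy of the complex numbers, which no
  finite type can hold. This settles the degenerate case of the labelling below, which needs an
  infinite type.\<close>

lemma finite_type_trivial:
  assumes "finite (UNIV :: 'a set)"
  shows "carrier S = {\<zero>}"
proof -
  have "x = \<zero>" if x: "x \<in> carrier S" for x
  proof (rule ccontr)
    assume "x \<noteq> \<zero>"
    then have "inj (\<lambda>c. c \<odot>\<^bsub>S\<^esub> x)"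
      by (intro injI scale_left_inj[OF x])
    then have "finite (UNIV :: complex set)"
      using assms finite_imageD finite_subset[OF subset_UNIV] by blast
    then show False using infinite_UNIV_char_0 by blast
  qed
  then show ?thesis by auto
qed

lemma adj_zero: "adj S \<zero> = \<zero>"
  using adj_smult[of \<zero> 0] by (simp add: scale_zero_left adj_closed scale_zero_right)

lemma mats_add_closed: "X \<in> mats S n \<Longrightarrow> Y \<in> mats S n \<Longrightarrow> mats_add S X Y \<in> mats S n"
  by (auto simp: mats_def mats_add_def)

lemma mats_smult_closed: "X \<in> mats S n \<Longrightarrow> mats_smult S c X \<in> mats S n"
  by (auto simp: mats_def mats_smult_def scale_closed)

lemma mats_adj_closed: "X \<in> mats S n \<Longrightarrow> mats_adj S X \<in> mats S n"
  by (auto simp: mats_def mats_adj_def adj_closed)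

lemma compress_entry_closed:
  "X \<in> mats S n \<Longrightarrow> k < n \<Longrightarrow>
    (\<lambda>l. (cnj (A $$ (k, i)) * A $$ (l, j)) \<odot>\<^bsub>S\<^esub> X $$ (k, l)) \<in> {..<n} \<rightarrow> carrier S"
  by (auto simp: mats_def scale_closed)

lemma compress_row_closed:
  "X \<in> mats S n \<Longrightarrow>
    (\<lambda>k. \<Oplus>l\<in>{..<n}. (cnj (A $$ (k, i)) * A $$ (l, j)) \<odot>\<^bsub>S\<^esub> X $$ (k, l)) \<in> {..<n} \<rightarrow> carrier S"
  using compress_entry_closed[of X n] by (auto intro!: M.finsum_closed)

end

section \<open>Linear maps\<close>

lemma linear_mapsD:
  assumes "f \<in> linear_maps S T"
  shows "x \<in> carrier S \<Longrightarrow> f x \<in> carrier T"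
    and "x \<in> carrier S \<Longrightarrow> y \<in> carrier S \<Longrightarrow> f (x \<oplus>\<^bsub>S\<^esub> y) = f x \<oplus>\<^bsub>T\<^esub> f y"
    and "x \<in> carrier S \<Longrightarrow> f (c \<odot>\<^bsub>S\<^esub> x) = c \<odot>\<^bsub>T\<^esub> f x"
  using assms unfolding linear_maps_def LinearCombinations.module_hom_def
  by (auto simp: class_ring_simps Pi_iff)

lemma linear_mapsI:
  assumes "\<And>x. x \<in> carrier S \<Longrightarrow> f x \<in> carrier T"
    and "\<And>x y. x \<in> carrier S \<Longrightarrow> y \<in> carrier S \<Longrightarrow> f (x \<oplus>\<^bsub>S\<^esub> y) = f x \<oplus>\<^bsub>T\<^esub> f y"
    and "\<And>c x. x \<in> carrier S \<Longrightarrow> f (c \<odot>\<^bsub>S\<^esub> x) = c \<odot>\<^bsub>T\<^esub> f x"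
  shows "f \<in> linear_maps S T"
  using assms unfolding linear_maps_def LinearCombinations.module_hom_def by auto

text \<open>Homogeneity with the scalar 0 gives this; \<open>linear_maps\<close> itself records only
  closure, additivity and homogeneity.\<close>

lemma linear_maps_zero:
  assumes "star_vector_space S" "star_vector_space T" "f \<in> linear_maps S T"
  shows "f \<zero>\<^bsub>S\<^esub> = \<zero>\<^bsub>T\<^esub>"
proof -
  interpret S: star_vector_space S by fact
  interpret T: star_vector_space T by fact
  have "f (0 \<odot>\<^bsub>S\<^esub> \<zero>\<^bsub>S\<^esub>) = 0 \<odot>\<^bsub>T\<^esub> f \<zero>\<^bsub>S\<^esub>"
    by (rule linear_mapsD(3)[OF assms(3)]) simp
  then show ?thesis
    using linear_mapsD(1)[OF assms(3)] by (simp add: S.scale_zero_left T.scale_zero_left)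
qed

lemma linear_maps_finsum:
  assumes "star_vector_space S" "star_vector_space T" and f: "f \<in> linear_maps S T"
    and "finite I" "g \<in> I \<rightarrow> carrier S"
  shows "f (\<Oplus>\<^bsub>S\<^esub>i\<in>I. g i) = (\<Oplus>\<^bsub>T\<^esub>i\<in>I. f (g i))"
proof -
  interpret S: star_vector_space S by fact
  interpret T: star_vector_space T by fact
  show ?thesis using assms(4,5)
  proof (induction rule: finite_induct)
    case empty
    then show ?case using linear_maps_zero[OF assms(1-3)] by simp
  next
    case (insert i I)
    moreover have "(\<lambda>i. f (g i)) \<in> I \<rightarrow> carrier T" "f (g i) \<in> carrier T"
      using insert linear_mapsD(1)[OF f] by auto
    moreover have "(\<Oplus>\<^bsub>S\<^esub>i\<in>I. g i) \<in> carrier S"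
      using insert by (intro S.M.finsum_closed) auto
    ultimately show ?case
      by (simp add: linear_mapsD(2)[OF f])
  qed
qed

section \<open>Entrywise application of maps to matrices\<close>

lemma mats_map:
  assumes "\<And>x. x \<in> carrier S \<Longrightarrow> f x \<in> carrier T" "X \<in> mats S n"
  shows "map_mat f X \<in> mats T n"
  using assms by (auto simp: mats_def)

lemma map_mat_cong_mats:
  assumes "X \<in> mats S n" "\<And>x. x \<in> carrier S \<Longrightarrow> f x = g x"
  shows "map_mat f X = map_mat g X"
  using assms by (intro eq_matI) (auto simp: mats_def)

lemma map_mat_comp: "map_mat f (map_mat g X) = map_mat (\<lambda>x. f (g x)) X"
  by (intro eq_matI) auto

lemma map_mat_ident: "map_mat (\<lambda>x. x) X = X"
  by (intro eq_matI) auto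

lemma map_mat_inj_on_mats:
  assumes "inj_on f (carrier S)" "X \<in> mats S n" "Y \<in> mats S n" "map_mat f X = map_mat f Y"
  shows "X = Y"
proof (rule eq_matI)
  fix i j assume "i < dim_row Y" "j < dim_col Y"
  moreover have "map_mat f X $$ (i, j) = map_mat f Y $$ (i, j)" using assms(4) by simp
  ultimately show "X $$ (i, j) = Y $$ (i, j)"
    using assms(1-3) by (auto simp: mats_def inj_on_def)
qed (use assms(2,3) in \<open>auto simp: mats_def\<close>)

lemma map_mat_mats_add:
  assumes "f \<in> linear_maps S T" "X \<in> mats S n" "Y \<in> mats S n"
  shows "map_mat f (mats_add S X Y) = mats_add T (map_mat f X) (map_mat f Y)"
  using assms(2,3) linear_mapsD[OF assms(1)]
  by (intro eq_matI) (auto simp: mats_def mats_add_def)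

lemma map_mat_mats_smult:
  assumes "f \<in> linear_maps S T" "X \<in> mats S n"
  shows "map_mat f (mats_smult S c X) = mats_smult T c (map_mat f X)"
  using assms(2) linear_mapsD[OF assms(1)]
  by (intro eq_matI) (auto simp: mats_def mats_smult_def)

lemma map_mat_mats_adj:
  assumes "\<And>x. x \<in> carrier S \<Longrightarrow> f (adj S x) = adj T (f x)" "X \<in> mats S n"
  shows "map_mat f (mats_adj S X) = mats_adj T (map_mat f X)"
  using assms by (intro eq_matI) (auto simp: mats_def mats_adj_def)

lemma map_mat_mats_zero:
  assumes "f \<zero>\<^bsub>S\<^esub> = \<zero>\<^bsub>T\<^esub>"
  shows "map_mat f (mats_zero S n) = mats_zero T n"
  using assms by (intro eq_matI) (auto simp: mats_zero_def)

lemma map_mat_mats_unit: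
  assumes "f \<zero>\<^bsub>S\<^esub> = \<zero>\<^bsub>T\<^esub>" "unital S T f"
  shows "map_mat f (mats_unit S n) = mats_unit T n"
  using assms by (intro eq_matI) (auto simp: mats_unit_def unital_def)

text \<open>Each entry of a compression is a finite linear combination of entries of
  \<open>X\<close>, so linearity of \<open>f\<close> suffices.\<close>

lemma map_mat_mats_compress:
  assumes S: "star_vector_space S" and T: "star_vector_space T" and f: "f \<in> linear_maps S T"
    and X: "X \<in> mats S n" and A: "A \<in> carrier_mat n m"
  shows "map_mat f (mats_compress S A X) = mats_compress T A (map_mat f X)"
proof -
  interpret S: star_vector_space S by fact
  interpret T: star_vector_space T by fact
  have n: "dim_row A = n" "dim_row X = n" "dim_col X = n" using A X by (auto simp: mats_def)
  have entry: "X $$ (k, l) \<in> carrier S" if "k < n" "l < n" for k l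
    using X that by (auto simp: mats_def)
  show ?thesis
    unfolding mats_compress_def n
    by (intro eq_matI)
      (auto simp: linear_maps_finsum[OF S T f] S.compress_row_closed[OF X]
        S.compress_entry_closed[OF X] linear_mapsD[OF f] entry n
        intro!: T.M.finsum_cong' T.M.finsum_closed T.scale_closed)
qed

section \<open>Adjoints under completely positive maps\<close>

lemma (in matrix_ordered_space) pos_mats: "n \<ge> 1 \<Longrightarrow> X \<in> pos S n \<Longrightarrow> X \<in> mats S n"
  using pos_herm by (auto simp: herm_def)

context operator_system
begin

lemma mats_unit_closed: "mats_unit S n \<in> mats S n"
  by (auto simp: mats_def mats_unit_def order_unit_closed)

lemma self_adjoint_herm:
  assumes "x \<in> carrier S" "adj S x = x"
  shows "mat 1 1 (\<lambda>_. x) \<in> herm S 1"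
  using assms unfolding herm_def mats_def mats_adj_def by auto

end

text \<open>A self-adjoint \<open>x\<close> is the difference of \<open>r e\<close> and the positive element \<open>r e - x\<close>.\<close>

lemma completely_positive_self_adjoint:
  assumes "operator_system S" "operator_system T" and cp: "completely_positive S T f"
    and x: "x \<in> carrier S" "adj S x = x"
  shows "adj T (f x) = f x"
proof -
  interpret S: operator_system S by fact
  interpret T: operator_system T by fact
  note f = linear_mapsD[OF cp[unfolded completely_positive_def, THEN conjunct1]]
  \<comment> \<open>The image of a positive \<open>1 x 1\<close> matrix is positive, hence hermitian
    by \<open>pos_herm\<close>; its single entry is read off.\<close>
  have pos: "adj T (f y) = f y" if y: "mat 1 1 (\<lambda>_. y) \<in> pos S 1" for y
  proof -
    have "map_mat f (mat 1 1 (\<lambda>_. y)) \<in> herm T 1"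
      using cp y T.pos_herm[of 1] unfolding completely_positive_def by fastforce
    then have "mats_adj T (map_mat f (mat 1 1 (\<lambda>_. y))) $$ (0, 0) = map_mat f (mat 1 1 (\<lambda>_. y)) $$ (0, 0)"
      by (simp add: herm_def)
    then show ?thesis by (simp add: mats_adj_def)
  qed
  have decomp: "\<exists>r::real. r > 0 \<and>
      mat 1 1 (\<lambda>_. complex_of_real r \<odot>\<^bsub>S\<^esub> order_unit S \<oplus>\<^bsub>S\<^esub> (-1) \<odot>\<^bsub>S\<^esub> y) \<in> pos S 1"
    if y: "y \<in> carrier S" "adj S y = y" for y
  proof -
    obtain r :: real where r: "r > 0"
      "mats_add S (mats_smult S (complex_of_real r) (mats_unit S 1)) (mats_smult S (- 1) (mat 1 1 (\<lambda>_. y))) \<in> pos S 1"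
      using S.matrix_order_unit[OF _ S.self_adjoint_herm[OF y]] by auto
    moreover have "mats_add S (mats_smult S (complex_of_real r) (mats_unit S 1)) (mats_smult S (- 1) (mat 1 1 (\<lambda>_. y)))
      = mat 1 1 (\<lambda>_. complex_of_real r \<odot>\<^bsub>S\<^esub> order_unit S \<oplus>\<^bsub>S\<^esub> (-1) \<odot>\<^bsub>S\<^esub> y)"
      by (intro eq_matI) (auto simp: mats_add_def mats_smult_def mats_unit_def)
    ultimately show ?thesis by auto
  qed
  obtain r where "r > 0" and
    rx: "mat 1 1 (\<lambda>_. complex_of_real r \<odot>\<^bsub>S\<^esub> order_unit S \<oplus>\<^bsub>S\<^esub> (-1) \<odot>\<^bsub>S\<^esub> x) \<in> pos S 1"
    using decomp[OF x] by blast
  \<comment> \<open>The image of the unit must be self-adjoint as well. Applying the order unit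
    property to zero makes a positive multiple of the unit positive, so \<open>pos\<close> applies
    to that multiple.\<close>
  obtain q where q: "(q::real) > 0" and
    qe: "mat 1 1 (\<lambda>_. complex_of_real q \<odot>\<^bsub>S\<^esub> order_unit S \<oplus>\<^bsub>S\<^esub> (-1) \<odot>\<^bsub>S\<^esub> \<zero>\<^bsub>S\<^esub>) \<in> pos S 1"
    using decomp[of "\<zero>\<^bsub>S\<^esub>"] by (auto simp: S.adj_zero)
  let ?e = "f (order_unit S)"
  have e: "?e \<in> carrier T" and fx: "f x \<in> carrier T" using f x S.order_unit_closed by auto
  have "adj T (complex_of_real q \<odot>\<^bsub>T\<^esub> ?e) = complex_of_real q \<odot>\<^bsub>T\<^esub> ?e"
    using pos[OF qe] f(3) S.order_unit_closed by (simp add: S.scale_zero_right S.scale_closed)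
  then have adj_e: "adj T ?e = ?e"
    using q T.scale_cancel[of "complex_of_real q" "adj T ?e" ?e] e
    by (simp add: T.adj_smult T.adj_closed)
  have "adj T (complex_of_real r \<odot>\<^bsub>T\<^esub> ?e \<oplus>\<^bsub>T\<^esub> (-1) \<odot>\<^bsub>T\<^esub> f x)
      = complex_of_real r \<odot>\<^bsub>T\<^esub> ?e \<oplus>\<^bsub>T\<^esub> (-1) \<odot>\<^bsub>T\<^esub> f x"
    using pos[OF rx] f S.order_unit_closed x by (simp add: S.scale_closed)
  then have "complex_of_real r \<odot>\<^bsub>T\<^esub> ?e \<oplus>\<^bsub>T\<^esub> (-1) \<odot>\<^bsub>T\<^esub> adj T (f x)
      = complex_of_real r \<odot>\<^bsub>T\<^esub> ?e \<oplus>\<^bsub>T\<^esub> (-1) \<odot>\<^bsub>T\<^esub> f x"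
    using e fx by (simp add: T.adj_add T.adj_smult T.scale_closed adj_e)
  then have "(-1) \<odot>\<^bsub>T\<^esub> adj T (f x) = (-1) \<odot>\<^bsub>T\<^esub> f x"
    using e fx by (simp add: T.scale_closed T.adj_closed)
  then show ?thesis
    using T.scale_cancel[of "-1" "adj T (f x)" "f x"] fx T.adj_closed by auto
qed

text \<open>With \<open>y = f x\<close> and \<open>z = f (x\<^sup>*)\<close>, self-adjointness of the images of \<open>x + x\<^sup>*\<close> and
  \<open>\<i> x + (\<i> x)\<^sup>*\<close> gives \<open>y\<^sup>* + z\<^sup>* = y + z\<close> and \<open>y\<^sup>* - z\<^sup>* = z - y\<close>; add them.\<close>

lemma completely_positive_adj:
  assumes S: "operator_system S" and T: "operator_system T" and cp: "completely_positive S T f"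
    and x: "x \<in> carrier S"
  shows "f (adj S x) = adj T (f x)"
proof -
  interpret S: operator_system S by fact
  interpret T: operator_system T by fact
  note f = linear_mapsD[OF cp[unfolded completely_positive_def, THEN conjunct1]]
  note sa = completely_positive_self_adjoint[OF S T cp]
  define y z where "y = f x" and "z = f (adj S x)"
  have yz [simp]: "y \<in> carrier T" "z \<in> carrier T" using f x S.adj_closed by (auto simp: y_def z_def)
  have [simp]: "adj T y \<in> carrier T" "adj T z \<in> carrier T"
    by (simp_all add: T.adj_closed)
  have 1: "adj T y \<oplus>\<^bsub>T\<^esub> adj T z = y \<oplus>\<^bsub>T\<^esub> z"
    using sa[of "x \<oplus>\<^bsub>S\<^esub> adj S x"] f x
    by (simp add: S.adj_closed S.adj_add S.adj_adj S.M.a_comm y_def[symmetric] z_def[symmetric] T.adj_add)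
  have 2: "cnj \<i> \<odot>\<^bsub>T\<^esub> adj T y \<oplus>\<^bsub>T\<^esub> \<i> \<odot>\<^bsub>T\<^esub> adj T z = \<i> \<odot>\<^bsub>T\<^esub> y \<oplus>\<^bsub>T\<^esub> cnj \<i> \<odot>\<^bsub>T\<^esub> z"
    using sa[of "\<i> \<odot>\<^bsub>S\<^esub> x \<oplus>\<^bsub>S\<^esub> cnj \<i> \<odot>\<^bsub>S\<^esub> adj S x"] f x
    by (simp add: S.adj_closed S.adj_add S.adj_adj S.M.a_comm S.scale_closed S.adj_smult
        y_def[symmetric] z_def[symmetric] T.adj_add T.adj_smult T.scale_closed)
  \<comment> \<open>Multiplying 2 by the imaginary unit turns all coefficients into signs, a form
    that can be added to 1.\<close>
  have "\<i> \<odot>\<^bsub>T\<^esub> (cnj \<i> \<odot>\<^bsub>T\<^esub> adj T y \<oplus>\<^bsub>T\<^esub> \<i> \<odot>\<^bsub>T\<^esub> adj T z)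
      = \<i> \<odot>\<^bsub>T\<^esub> (\<i> \<odot>\<^bsub>T\<^esub> y \<oplus>\<^bsub>T\<^esub> cnj \<i> \<odot>\<^bsub>T\<^esub> z)"
    using 2 by simp
  then have 3: "adj T y \<oplus>\<^bsub>T\<^esub> (-1) \<odot>\<^bsub>T\<^esub> adj T z = (-1) \<odot>\<^bsub>T\<^esub> y \<oplus>\<^bsub>T\<^esub> z"
    by (simp add: T.scale_add_right T.scale_scale T.scale_closed T.scale_one)
  have cancel: "u \<oplus>\<^bsub>T\<^esub> (-1) \<odot>\<^bsub>T\<^esub> u = \<zero>\<^bsub>T\<^esub>" if "u \<in> carrier T" for u
    using T.scale_add_left[of u 1 "-1"] that by (simp add: T.scale_zero_left T.scale_one)
  have double: "u \<oplus>\<^bsub>T\<^esub> u = 2 \<odot>\<^bsub>T\<^esub> u" if "u \<in> carrier T" for u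
    using T.scale_add_left[of u 1 1] that by (simp add: T.scale_one)
  have "2 \<odot>\<^bsub>T\<^esub> adj T y = (adj T y \<oplus>\<^bsub>T\<^esub> adj T y) \<oplus>\<^bsub>T\<^esub> (adj T z \<oplus>\<^bsub>T\<^esub> (-1) \<odot>\<^bsub>T\<^esub> adj T z)"
    by (simp add: cancel double T.scale_closed)
  also have "\<dots> = (adj T y \<oplus>\<^bsub>T\<^esub> adj T z) \<oplus>\<^bsub>T\<^esub> (adj T y \<oplus>\<^bsub>T\<^esub> (-1) \<odot>\<^bsub>T\<^esub> adj T z)"
    by (simp add: T.M.a_ac T.scale_closed)
  also have "\<dots> = (y \<oplus>\<^bsub>T\<^esub> z) \<oplus>\<^bsub>T\<^esub> ((-1) \<odot>\<^bsub>T\<^esub> y \<oplus>\<^bsub>T\<^esub> z)"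
    using 1 3 by simp
  also have "\<dots> = (z \<oplus>\<^bsub>T\<^esub> z) \<oplus>\<^bsub>T\<^esub> (y \<oplus>\<^bsub>T\<^esub> (-1) \<odot>\<^bsub>T\<^esub> y)"
    by (simp add: T.M.a_ac T.scale_closed)
  also have "\<dots> = 2 \<odot>\<^bsub>T\<^esub> z"
    by (simp add: cancel double T.scale_closed)
  finally have "adj T y = z"
    using T.scale_cancel[of 2 "adj T y" z] by simp
  then show ?thesis by (simp add: y_def z_def)
qed

subsection \<open>Complete order embeddings\<close>

text \<open>The working form of the notion. Complete positivity of the inverse on the range amounts
  to \<open>f\<close> reflecting positivity, since a matrix with entries in the range is
  \<open>map_mat f\<close> of a matrix over \<open>S\<close>.\<close>

lemma complete_order_embedding_iff:
  assumes "operator_system S" "operator_system T"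
  shows "complete_order_embedding S T f \<longleftrightarrow> f \<in> linear_maps S T \<and> inj_on f (carrier S) \<and>
    (\<forall>n\<ge>1. \<forall>X\<in>mats S n. map_mat f X \<in> pos T n \<longleftrightarrow> X \<in> pos S n)"
proof -
  interpret S: operator_system S by fact
  interpret T: operator_system T by fact
  let ?R = "restrict_opsys T (f ` carrier S)"
  have ops: "add ?R = add T" "module.smult ?R = module.smult T" "carrier ?R = f ` carrier S"
    by (simp_all add: restrict_opsys_def)
  have pos_R: "pos ?R n = {X \<in> pos T n. \<forall>i<n. \<forall>j<n. X $$ (i, j) \<in> f ` carrier S}" for n
    by (simp add: restrict_opsys_def)
  \<comment> \<open>The entry condition in the restricted cones is automatic for images of matrices
    over \<open>S\<close>.\<close>
  have image_R: "map_mat f X \<in> pos ?R n \<longleftrightarrow> map_mat f X \<in> pos T n" if "X \<in> mats S n" for X n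
    using that by (auto simp: pos_R mats_def)
  have inverse_mat: "map_mat (inv_into (carrier S) f) (map_mat f X) = X"
    if "inj_on f (carrier S)" "X \<in> mats S n" for X n
  proof -
    have "map_mat (inv_into (carrier S) f) (map_mat f X) = map_mat (\<lambda>x. x) X"
      unfolding map_mat_comp by (rule map_mat_cong_mats) (use that in auto)
    then show ?thesis by (simp add: map_mat_ident)
  qed
  show ?thesis
  proof
    assume emb: "complete_order_embedding S T f"
    then have f: "f \<in> carrier S \<rightarrow> carrier T" and inj: "inj_on f (carrier S)"
      and lin: "f \<in> linear_maps S ?R" and cp: "completely_positive S ?R f"
      and cp': "completely_positive ?R S (inv_into (carrier S) f)"
      by (auto simp: complete_order_embedding_def complete_order_iso_def completely_positive_def
          bij_betw_def)
    have "f \<in> linear_maps S T"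
      using f linear_mapsD[OF lin] by (intro linear_mapsI) (auto simp: ops)
    moreover have "map_mat f X \<in> pos T n \<longleftrightarrow> X \<in> pos S n" if n: "n \<ge> 1" and X: "X \<in> mats S n" for X n
    proof
      assume "map_mat f X \<in> pos T n"
      then have "map_mat (inv_into (carrier S) f) (map_mat f X) \<in> pos S n"
        using cp' n image_R[OF X] by (simp add: completely_positive_def)
      then show "X \<in> pos S n" by (simp add: inverse_mat[OF inj X])
    next
      assume "X \<in> pos S n"
      then show "map_mat f X \<in> pos T n"
        using cp n image_R[OF X] by (simp add: completely_positive_def)
    qed
    ultimately show "f \<in> linear_maps S T \<and> inj_on f (carrier S) \<and>
      (\<forall>n\<ge>1. \<forall>X\<in>mats S n. map_mat f X \<in> pos T n \<longleftrightarrow> X \<in> pos S n)"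
      using inj by blast
  next
    assume "f \<in> linear_maps S T \<and> inj_on f (carrier S) \<and>
      (\<forall>n\<ge>1. \<forall>X\<in>mats S n. map_mat f X \<in> pos T n \<longleftrightarrow> X \<in> pos S n)"
    then have lin: "f \<in> linear_maps S T" and inj: "inj_on f (carrier S)"
      and pos_iff: "\<And>n X. n \<ge> 1 \<Longrightarrow> X \<in> mats S n \<Longrightarrow> map_mat f X \<in> pos T n \<longleftrightarrow> X \<in> pos S n"
      by auto
    note f = linear_mapsD[OF lin]
    let ?g = "inv_into (carrier S) f"
    have "completely_positive S ?R f"
      unfolding completely_positive_def
    proof (intro conjI allI ballI impI)
      show "f \<in> linear_maps S ?R" using f by (intro linear_mapsI) (auto simp: ops)
      show "map_mat f X \<in> pos ?R n" if "n \<ge> 1" "X \<in> pos S n" for n X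
        using that pos_iff image_R S.pos_mats by auto
    qed
    moreover have "completely_positive ?R S ?g"
      unfolding completely_positive_def
    proof (intro conjI allI ballI impI)
      have g: "?g (f x) = x" if "x \<in> carrier S" for x using inj that by simp
      have "?g (f x \<oplus>\<^bsub>T\<^esub> f y) = x \<oplus>\<^bsub>S\<^esub> y" if "x \<in> carrier S" "y \<in> carrier S" for x y
        using that g[of "x \<oplus>\<^bsub>S\<^esub> y"] f by simp
      moreover have "?g (c \<odot>\<^bsub>T\<^esub> f x) = c \<odot>\<^bsub>S\<^esub> x" if "x \<in> carrier S" for c x
        using that g[of "c \<odot>\<^bsub>S\<^esub> x"] f S.scale_closed by simp
      ultimately show "?g \<in> linear_maps ?R S"
        using g by (intro linear_mapsI) (auto simp: ops)
      show "map_mat ?g X \<in> pos S n" if n: "n \<ge> 1" and X: "X \<in> pos ?R n" for n X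
      proof -
        have XR: "X \<in> mats T n" "\<And>i j. i < n \<Longrightarrow> j < n \<Longrightarrow> X $$ (i, j) \<in> f ` carrier S"
          using X n T.pos_mats by (auto simp: pos_R)
        have mem: "map_mat ?g X \<in> mats S n"
          using XR by (auto simp: mats_def intro!: inv_into_into)
        have "map_mat f (map_mat ?g X) = X"
          using XR by (intro eq_matI) (auto simp: mats_def f_inv_into_f)
        then show ?thesis using pos_iff[OF n mem] X by (simp add: pos_R)
      qed
    qed
    ultimately show "complete_order_embedding S T f"
      using inj f by (auto simp: complete_order_embedding_def complete_order_iso_def bij_betw_def ops)
  qed
qed

lemma complete_order_embeddingD:
  assumes "operator_system S" "operator_system T" "complete_order_embedding S T f"
  shows "f \<in> linear_maps S T" "inj_on f (carrier S)"
    and "n \<ge> 1 \<Longrightarrow> X \<in> mats S n \<Longrightarrow> map_mat f X \<in> pos T n \<longleftrightarrow> X \<in> pos S n"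
  using assms(3) unfolding complete_order_embedding_iff[OF assms(1,2)] by auto

lemma complete_order_embedding_comp:
  assumes S: "operator_system S" and T: "operator_system T" and U: "operator_system U"
    and f: "complete_order_embedding S T f" and g: "complete_order_embedding T U g"
  shows "complete_order_embedding S U (\<lambda>x. g (f x))"
proof -
  note f = complete_order_embeddingD[OF S T f] and g = complete_order_embeddingD[OF T U g]
  note fl = linear_mapsD[OF f(1)] and gl = linear_mapsD[OF g(1)]
  have "map_mat (\<lambda>x. g (f x)) X \<in> pos U n \<longleftrightarrow> X \<in> pos S n" if "n \<ge> 1" "X \<in> mats S n" for n X
    using that f(3)[of n X] g(3)[of n "map_mat f X"] mats_map[of S f T X n] fl
    by (simp add: map_mat_comp)
  moreover have "inj_on (\<lambda>x. g (f x)) (carrier S)"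
    using f(2) g(2) fl by (auto simp: inj_on_def)
  moreover have "(\<lambda>x. g (f x)) \<in> linear_maps S U"
    using fl gl by (intro linear_mapsI) auto
  ultimately show ?thesis
    using complete_order_embedding_iff[OF S U] by blast
qed

lemma complete_order_embedding_ident:
  assumes "operator_system S"
  shows "complete_order_embedding S S (\<lambda>x. x)"
  unfolding complete_order_embedding_iff[OF assms assms]
  by (auto intro: linear_mapsI simp: map_mat_ident)

section \<open>Unital completely positive maps\<close>

lemma unital_embedding_ucp:
  assumes "operator_system S" "operator_system T" "unital S T f" "complete_order_embedding S T f"
  shows "ucp S T f"
proof -
  interpret S: operator_system S by fact
  show ?thesis
    using complete_order_embeddingD[OF assms(1,2,4)] assms(3) S.pos_mats
    by (auto simp: ucp_def completely_positive_def)
qed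

lemma ucpD:
  assumes "ucp S T f"
  shows "f \<in> linear_maps S T" "f (order_unit S) = order_unit T"
    and "n \<ge> 1 \<Longrightarrow> X \<in> pos S n \<Longrightarrow> map_mat f X \<in> pos T n"
  using assms by (auto simp: ucp_def completely_positive_def unital_def)

lemma ucp_ident: "ucp S S (\<lambda>x. x)"
  by (auto simp: ucp_def completely_positive_def unital_def map_mat_ident intro: linear_mapsI)

lemma ucp_comp:
  assumes f: "ucp S T f" and g: "ucp T U g"
  shows "ucp S U (\<lambda>x. g (f x))"
proof -
  note fl = linear_mapsD[OF ucpD(1)[OF f]] and gl = linear_mapsD[OF ucpD(1)[OF g]]
  have "(\<lambda>x. g (f x)) \<in> linear_maps S U"
    using fl gl by (intro linear_mapsI) auto
  moreover have "map_mat (\<lambda>x. g (f x)) X \<in> pos U n" if "n \<ge> 1" "X \<in> pos S n" for n X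
    using ucpD(3)[OF g that(1) ucpD(3)[OF f that]] by (simp add: map_mat_comp)
  ultimately show ?thesis
    using ucpD(2)[OF f] ucpD(2)[OF g] by (auto simp: ucp_def completely_positive_def unital_def)
qed

subsection \<open>Cocones over a sequence\<close>

text \<open>The finiteness principle behind all arguments with levels: of any two terms the later
  one contains the other, so finitely many elements can be collected in one term.\<close>

lemma finite_subset_incseq:
  fixes A :: "nat \<Rightarrow> 'a set"
  assumes "incseq A" "finite F" "F \<subseteq> (\<Union>k. A k)"
  shows "\<exists>k. F \<subseteq> A k"
  using assms(2,3)
proof (induction rule: finite_induct)
  case (insert x F)
  then obtain k j where "F \<subseteq> A k" "x \<in> A j" by auto
  moreover have "A k \<subseteq> A (max k j)" "A j \<subseteq> A (max k j)"
    using assms(1) by (auto simp: incseq_def)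
  ultimately show ?case by blast
qed simp

text \<open>An element of level \<open>k\<close> and its successor under \<open>f k\<close> have the
  same image.\<close>

lemma cocone_incseq:
  assumes "\<And>k x. x \<in> A k \<Longrightarrow> f k x \<in> A (Suc k)" "\<And>k x. x \<in> A k \<Longrightarrow> \<rho> (Suc k) (f k x) = \<rho> k x"
  shows "incseq (\<lambda>k. \<rho> k ` A k)"
proof (rule incseq_SucI)
  show "\<rho> k ` A k \<subseteq> \<rho> (Suc k) ` A (Suc k)" for k
    using assms by (metis image_subsetI image_eqI)
qed

text \<open>A matrix has finitely many entries, so one level contains preimages of all of them;
  \<open>inv_into\<close> chooses these.\<close>

lemma mats_from_level:
  assumes "incseq (\<lambda>k. \<rho> k ` carrier (S k))" "carrier R \<subseteq> (\<Union>k. \<rho> k ` carrier (S k))" "X \<in> mats R n"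
  shows "\<exists>k. \<exists>Y\<in>mats (S k) n. X = map_mat (\<rho> k) Y"
proof -
  let ?F = "(\<lambda>ij. X $$ ij) ` ({..<n} \<times> {..<n})"
  have "?F \<subseteq> (\<Union>k. \<rho> k ` carrier (S k))"
    using assms(2,3) by (auto simp: mats_def)
  then obtain k where k: "?F \<subseteq> \<rho> k ` carrier (S k)"
    using finite_subset_incseq[OF assms(1), of ?F] by auto
  let ?g = "inv_into (carrier (S k)) (\<rho> k)"
  have entry: "X $$ (i, j) \<in> \<rho> k ` carrier (S k)" if "i < n" "j < n" for i j
    using k that by auto
  have "map_mat ?g X \<in> mats (S k) n"
    using assms(3) entry by (auto simp: mats_def intro!: inv_into_into)
  moreover have "X = map_mat (\<rho> k) (map_mat ?g X)"
    using assms(3) entry by (intro eq_matI) (auto simp: mats_def f_inv_into_f)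
  ultimately show ?thesis by blast
qed

text \<open>Indexing by the number \<open>d\<close> of steps instead of a target level avoids the
  side condition \<open>k \<le> j\<close>. Levels \<open>k\<close> and \<open>j\<close> are compared
  at the common level \<open>k + j\<close>.\<close>

primrec transition :: "(nat \<Rightarrow> 'a \<Rightarrow> 'a) \<Rightarrow> nat \<Rightarrow> nat \<Rightarrow> 'a \<Rightarrow> 'a" where
  "transition f k 0 = (\<lambda>x. x)"
| "transition f k (Suc d) = (\<lambda>x. f (k + d) (transition f k d x))"

text \<open>The set-level inductive limit of injections fits into the type \<open>'a\<close> itself: new
  elements of the \<open>k\<close>-th set receive the label \<open>(k, x)\<close>, and \<open>nat \<times> 'a\<close> injects into \<open>'a\<close>.\<close>

primrec cocone_labels :: "(nat \<times> 'a \<Rightarrow> 'a) \<Rightarrow> (nat \<Rightarrow> 'a set) \<Rightarrow> (nat \<Rightarrow> 'a \<Rightarrow> 'a) \<Rightarrow> nat \<Rightarrow> 'a \<Rightarrow> 'a" where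
  "cocone_labels g A f 0 = (\<lambda>x. g (0, x))"
| "cocone_labels g A f (Suc k) = (\<lambda>y. if y \<in> f k ` A k
     then cocone_labels g A f k (inv_into (A k) (f k) y) else g (Suc k, y))"

text \<open>The universal property in \<open>inductive_limit\<close> tests only systems carried by
  the type of the \<open>S k\<close>, so the union of the levels has to be realised inside that very
  type.\<close>

lemma injective_cocone_exists:
  fixes A :: "nat \<Rightarrow> 'a set"
  assumes "infinite (UNIV :: 'a set)" and inj: "\<And>k. inj_on (f k) (A k)"
  shows "\<exists>\<rho> :: nat \<Rightarrow> 'a \<Rightarrow> 'a. \<forall>k. inj_on (\<rho> k) (A k) \<and> (\<forall>x\<in>A k. \<rho> (Suc k) (f k x) = \<rho> k x)"
proof -
  \<comment> \<open>For infinite \<open>'a\<close> the product \<open>nat \<times> 'a\<close> has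
    the cardinality of \<open>'a\<close>, which provides the injective labelling
    \<open>g\<close>.\<close>
  have "ordLeq3 (card_of (UNIV :: nat set)) (card_of (UNIV :: 'a set))"
    using assms(1) infinite_iff_card_of_nat by blast
  then have "ordIso2 (card_of ((UNIV :: nat set) \<times> (UNIV :: 'a set))) (card_of (UNIV :: 'a set))"
    using card_of_Times_infinite_simps(3)[OF assms(1)] by blast
  then obtain g :: "nat \<times> 'a \<Rightarrow> 'a" where g: "inj g"
    using card_of_ordIso[of "(UNIV :: nat set) \<times> (UNIV :: 'a set)" "UNIV :: 'a set"]
    by (auto simp: bij_betw_def)
  define \<rho> where "\<rho> = cocone_labels g A f"
  \<comment> \<open>The induction carries a bound along: labels used up to level \<open>k\<close>
    have first component at most \<open>k\<close>, so the labels \<open>(Suc k, y)\<close> cannot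
    collide with them.\<close>
  have new: "inj_on (\<rho> k) (A k) \<and> \<rho> k ` A k \<subseteq> g ` ({..k} \<times> UNIV)" for k
  proof (induction k)
    case 0
    show ?case using g by (auto simp: \<rho>_def inj_on_def)
  next
    case (Suc k)
    have old: "\<rho> (Suc k) (f k x) = \<rho> k x" if "x \<in> A k" for x
      using that inj[of k] by (simp add: \<rho>_def)
    have fresh: "\<rho> (Suc k) y = g (Suc k, y)" if "y \<notin> f k ` A k" for y
      using that by (simp add: \<rho>_def)
    have "\<rho> (Suc k) y \<in> g ` ({..Suc k} \<times> UNIV)" for y
      using old fresh[of y] Suc by (cases "y \<in> f k ` A k") fastforce+
    moreover have "y = z" if eq: "\<rho> (Suc k) y = \<rho> (Suc k) z" for y z
    proof (cases "y \<in> f k ` A k"; cases "z \<in> f k ` A k")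
      assume "y \<in> f k ` A k" "z \<in> f k ` A k"
      then obtain x x' where x: "x \<in> A k" "y = f k x" and x': "x' \<in> A k" "z = f k x'" by auto
      then have "\<rho> k x = \<rho> k x'" using eq old[OF x(1)] old[OF x'(1)] by simp
      then show ?thesis using Suc x x' inj_onD by metis
    next
      assume "y \<in> f k ` A k" and z: "z \<notin> f k ` A k"
      then obtain x where x: "x \<in> A k" "y = f k x" by auto
      then have "\<rho> k x = g (Suc k, z)" using eq old[OF x(1)] fresh[OF z] by simp
      then have "g (Suc k, z) \<in> g ` ({..k} \<times> UNIV)" using x Suc by (metis image_subset_iff)
      then show ?thesis using g by (auto simp: inj_image_mem_iff)
    next
      assume y: "y \<notin> f k ` A k" and "z \<in> f k ` A k"
      then obtain x where x: "x \<in> A k" "z = f k x" by auto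
      then have "\<rho> k x = g (Suc k, y)" using eq old[OF x(1)] fresh[OF y] by simp
      then have "g (Suc k, y) \<in> g ` ({..k} \<times> UNIV)" using x Suc by (metis image_subset_iff)
      then show ?thesis using g by (auto simp: inj_image_mem_iff)
    next
      assume "y \<notin> f k ` A k" "z \<notin> f k ` A k"
      then show ?thesis using eq fresh[of y] fresh[of z] g by (simp add: inj_eq)
    qed
    ultimately show ?case by (auto simp: inj_on_def)
  qed
  moreover have "\<rho> (Suc k) (f k x) = \<rho> k x" if "x \<in> A k" for k x
    using that inj[of k] by (simp add: \<rho>_def)
  ultimately show ?thesis by blast
qed

subsection \<open>The inductive limit of complete order embeddings\<close>

text \<open>When the \<open>\<rho> k\<close> are compatible injections, the values do not depend on the level \<open>k\<close>
  at which \<open>SOME\<close> picks representatives.\<close>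

definition direct_limit :: "(nat \<Rightarrow> 'a opsys) \<Rightarrow> (nat \<Rightarrow> 'a \<Rightarrow> 'b) \<Rightarrow> 'b opsys" where
  "direct_limit S \<rho> = \<lparr>
     carrier = (\<Union>k. \<rho> k ` carrier (S k)),
     mult = undefined,
     one = undefined,
     zero = \<rho> 0 \<zero>\<^bsub>S 0\<^esub>,
     add = (\<lambda>x y. SOME z. \<exists>k. \<exists>a\<in>carrier (S k). \<exists>b\<in>carrier (S k).
       x = \<rho> k a \<and> y = \<rho> k b \<and> z = \<rho> k (a \<oplus>\<^bsub>S k\<^esub> b)),
     smult = (\<lambda>c x. SOME z. \<exists>k. \<exists>a\<in>carrier (S k). x = \<rho> k a \<and> z = \<rho> k (c \<odot>\<^bsub>S k\<^esub> a)),
     adj = (\<lambda>x. SOME z. \<exists>k. \<exists>a\<in>carrier (S k). x = \<rho> k a \<and> z = \<rho> k (adj (S k) a)),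
     order_unit = \<rho> 0 (order_unit (S 0)),
     pos = (\<lambda>n. \<Union>k. map_mat (\<rho> k) ` pos (S k) n)\<rparr>"

text \<open>The maps \<open>\<rho> k\<close> are mere injections of sets; the linear and order
  structure is transported along them to the union of their ranges.\<close>

locale injective_cocone =
  fixes S :: "nat \<Rightarrow> 'a opsys" and f :: "nat \<Rightarrow> 'a \<Rightarrow> 'a" and \<rho> :: "nat \<Rightarrow> 'a \<Rightarrow> 'b"
  assumes sys: "inductive_system S f"
    and embedding: "complete_order_embedding (S k) (S (Suc k)) (f k)"
    and inj: "inj_on (\<rho> k) (carrier (S k))"
    and compat: "x \<in> carrier (S k) \<Longrightarrow> \<rho> (Suc k) (f k x) = \<rho> k x"
begin

abbreviation "R \<equiv> direct_limit S \<rho>"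

lemma opsys: "operator_system (S k)"
  using sys by (simp add: inductive_system_def)

lemma star: "star_vector_space (S k)"
  using opsys[of k] by (simp add: operator_system_def matrix_ordered_space_def)

lemma order_unit_closed: "order_unit (S k) \<in> carrier (S k)"
  using operator_system.order_unit_closed[OF opsys] .

lemma zero_closed: "\<zero>\<^bsub>S k\<^esub> \<in> carrier (S k)"
proof -
  interpret S: operator_system "S k" by (rule opsys)
  show ?thesis by simp
qed

lemma add_closed:
  assumes "a \<in> carrier (S k)" "b \<in> carrier (S k)"
  shows "a \<oplus>\<^bsub>S k\<^esub> b \<in> carrier (S k)"
proof -
  interpret S: operator_system "S k" by (rule opsys)
  show ?thesis using assms by simp
qed

lemma smult_closed: "a \<in> carrier (S k) \<Longrightarrow> c \<odot>\<^bsub>S k\<^esub> a \<in> carrier (S k)"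
  using star_vector_space.scale_closed[OF star] .

lemma adj_closed: "a \<in> carrier (S k) \<Longrightarrow> adj (S k) a \<in> carrier (S k)"
  using star_vector_space.adj_closed[OF star] .

section \<open>Transition maps between levels\<close>

lemma unital_transition:
  "unital (S k) (S (k + d)) (transition f k d) \<and>
   complete_order_embedding (S k) (S (k + d)) (transition f k d)"
proof (induction d)
  case 0
  then show ?case
    using complete_order_embedding_ident[OF opsys] by (simp add: unital_def)
next
  case (Suc d)
  have "unital (S (k + d)) (S (Suc (k + d))) (f (k + d))"
    using sys by (simp add: inductive_system_def ucp_def)
  then show ?case
    using Suc complete_order_embedding_comp[OF opsys opsys opsys _ embedding]
    by (simp add: unital_def)
qed

lemmas transition_embedding = complete_order_embeddingD[OF opsys opsys unital_transition[THEN conjunct2]]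
lemmas transition_linear = linear_mapsD[OF transition_embedding(1)]

text \<open>A unital embedding is completely positive and so preserves adjoints by
  \<open>completely_positive_adj\<close>. This makes the adjoint of the union well defined.\<close>

lemma transition_adj:
  "x \<in> carrier (S k) \<Longrightarrow> transition f k d (adj (S k) x) = adj (S (k + d)) (transition f k d x)"
  using unital_transition[of k d] unital_embedding_ucp[OF opsys opsys, of k "k + d"]
  by (intro completely_positive_adj[OF opsys opsys]) (auto simp: ucp_def)

lemma transition_compat:
  "x \<in> carrier (S k) \<Longrightarrow> \<rho> (k + d) (transition f k d x) = \<rho> k x"
  by (induction d) (simp_all add: compat transition_linear(1))

text \<open>Pushing both elements to the common level \<open>k + j\<close> keeps their labels, and
  \<open>\<rho> (k + j)\<close> is injective there. The choices in \<open>direct_limit\<close> are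
  well defined for this reason.\<close>

lemma transition_eq:
  assumes "x \<in> carrier (S k)" "y \<in> carrier (S j)" "\<rho> k x = \<rho> j y"
  shows "transition f k j x = transition f j k y"
proof (rule inj_onD[OF inj])
  show "\<rho> (k + j) (transition f k j x) = \<rho> (k + j) (transition f j k y)"
    using assms transition_compat[of x k j] transition_compat[of y j k] by (simp add: add.commute)
  show "transition f k j x \<in> carrier (S (k + j))" "transition f j k y \<in> carrier (S (k + j))"
    using assms transition_linear(1)[of x k j] transition_linear(1)[of y j k]
    by (simp_all add: add.commute)
qed

section \<open>Operations of the direct limit, computed at an arbitrary level\<close>

lemma add_limit:
  assumes a: "a \<in> carrier (S k)" and b: "b \<in> carrier (S k)"
  shows "\<rho> k a \<oplus>\<^bsub>R\<^esub> \<rho> k b = \<rho> k (a \<oplus>\<^bsub>S k\<^esub> b)"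
proof -
  \<comment> \<open>Representatives at another level \<open>j\<close> give the same sum: both sums
    are moved to the common level of \<open>j\<close> and \<open>k\<close>, where the
    representatives coincide. Hence \<open>SOME\<close> has only one possible value.\<close>
  have "\<rho> j (a' \<oplus>\<^bsub>S j\<^esub> b') = \<rho> k (a \<oplus>\<^bsub>S k\<^esub> b)"
    if ab': "a' \<in> carrier (S j)" "b' \<in> carrier (S j)" and eq: "\<rho> k a = \<rho> j a'" "\<rho> k b = \<rho> j b'" for j a' b'
  proof -
    have "\<rho> j (a' \<oplus>\<^bsub>S j\<^esub> b') = \<rho> (j + k) (transition f j k (a' \<oplus>\<^bsub>S j\<^esub> b'))"
      using ab' by (simp add: transition_compat add_closed)
    also have "\<dots> = \<rho> (k + j) (transition f k j (a \<oplus>\<^bsub>S k\<^esub> b))"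
      using ab' a b transition_eq[OF a ab'(1) eq(1)] transition_eq[OF b ab'(2) eq(2)]
      by (simp add: transition_linear add.commute)
    also have "\<dots> = \<rho> k (a \<oplus>\<^bsub>S k\<^esub> b)"
      using a b by (simp add: transition_compat add_closed)
    finally show ?thesis .
  qed
  note unique = this
  show ?thesis
    unfolding direct_limit_def
    by (simp, rule some_equality) (use a b in blast, use unique in metis)
qed

lemma smult_limit:
  assumes a: "a \<in> carrier (S k)"
  shows "c \<odot>\<^bsub>R\<^esub> \<rho> k a = \<rho> k (c \<odot>\<^bsub>S k\<^esub> a)"
proof -
  have "\<rho> j (c \<odot>\<^bsub>S j\<^esub> a') = \<rho> k (c \<odot>\<^bsub>S k\<^esub> a)"
    if a': "a' \<in> carrier (S j)" and eq: "\<rho> k a = \<rho> j a'" for j a'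
  proof -
    have "\<rho> j (c \<odot>\<^bsub>S j\<^esub> a') = \<rho> (j + k) (transition f j k (c \<odot>\<^bsub>S j\<^esub> a'))"
      using a' by (simp add: transition_compat smult_closed)
    also have "\<dots> = \<rho> (k + j) (transition f k j (c \<odot>\<^bsub>S k\<^esub> a))"
      using a' a transition_eq[OF a a' eq] by (simp add: transition_linear add.commute)
    also have "\<dots> = \<rho> k (c \<odot>\<^bsub>S k\<^esub> a)"
      using a by (simp add: transition_compat smult_closed)
    finally show ?thesis .
  qed
  note unique = this
  show ?thesis
    unfolding direct_limit_def
    by (simp, rule some_equality) (use a in blast, use unique in metis)
qed

lemma adj_limit:
  assumes a: "a \<in> carrier (S k)"
  shows "adj R (\<rho> k a) = \<rho> k (adj (S k) a)"
proof -
  have "\<rho> j (adj (S j) a') = \<rho> k (adj (S k) a)"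
    if a': "a' \<in> carrier (S j)" and eq: "\<rho> k a = \<rho> j a'" for j a'
  proof -
    have "\<rho> j (adj (S j) a') = \<rho> (j + k) (transition f j k (adj (S j) a'))"
      using a' by (simp add: transition_compat adj_closed)
    also have "\<dots> = \<rho> (k + j) (transition f k j (adj (S k) a))"
      using a' a transition_eq[OF a a' eq] by (simp add: transition_adj add.commute)
    also have "\<dots> = \<rho> k (adj (S k) a)"
      using a by (simp add: transition_compat adj_closed)
    finally show ?thesis .
  qed
  note unique = this
  show ?thesis
    unfolding direct_limit_def
    by (simp, rule some_equality) (use a in blast, use unique in metis)
qed

text \<open>The zero of the union is defined at level 0; transitions carry it to every other
  level.\<close>

lemma zero_limit: "\<rho> k \<zero>\<^bsub>S k\<^esub> = \<zero>\<^bsub>R\<^esub>"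
  using transition_compat[OF zero_closed, of 0 k]
    linear_maps_zero[OF star star transition_embedding(1), of 0 k]
  by (simp add: direct_limit_def)

lemma unit_limit: "\<rho> k (order_unit (S k)) = order_unit R"
  using transition_compat[OF order_unit_closed, of 0 k] unital_transition[of 0 k]
  by (simp add: direct_limit_def unital_def)

lemma carrier_limit: "carrier R = (\<Union>k. \<rho> k ` carrier (S k))"
  by (simp add: direct_limit_def)

section \<open>Representing elements and matrices at a single level\<close>

lemma level_closed: "a \<in> carrier (S k) \<Longrightarrow> \<rho> k a \<in> carrier R"
  by (auto simp: carrier_limit)

lemma incseq_levels: "incseq (\<lambda>k. \<rho> k ` carrier (S k))"
  using transition_linear(1)[of _ _ 1] compat by (intro cocone_incseq[of _ f]) auto

lemma from_level:
  assumes "finite F" "F \<subseteq> carrier R"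
  obtains k where "F \<subseteq> \<rho> k ` carrier (S k)"
  using finite_subset_incseq[OF incseq_levels assms(1)] assms(2) by (auto simp: carrier_limit)

lemma from_level1:
  assumes "x \<in> carrier R"
  obtains k a where "a \<in> carrier (S k)" "x = \<rho> k a"
  using assms by (auto simp: carrier_limit)

lemma from_level2:
  assumes "x \<in> carrier R" "y \<in> carrier R"
  obtains k a b where "a \<in> carrier (S k)" "x = \<rho> k a" "b \<in> carrier (S k)" "y = \<rho> k b"
proof -
  obtain k where "{x, y} \<subseteq> \<rho> k ` carrier (S k)"
    by (rule from_level[of "{x, y}"]) (use assms in auto)
  then have "x \<in> \<rho> k ` carrier (S k)" "y \<in> \<rho> k ` carrier (S k)"
    by simp_all
  then show thesis by (elim imageE) (rule that)
qed

lemma from_level3: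
  assumes "x \<in> carrier R" "y \<in> carrier R" "z \<in> carrier R"
  obtains k a b c where "a \<in> carrier (S k)" "x = \<rho> k a" "b \<in> carrier (S k)" "y = \<rho> k b"
    "c \<in> carrier (S k)" "z = \<rho> k c"
proof -
  obtain k where "{x, y, z} \<subseteq> \<rho> k ` carrier (S k)"
    by (rule from_level[of "{x, y, z}"]) (use assms in auto)
  then have "x \<in> \<rho> k ` carrier (S k)" "y \<in> \<rho> k ` carrier (S k)" "z \<in> \<rho> k ` carrier (S k)"
    by simp_all
  then show thesis by (elim imageE) (rule that)
qed

lemma from_level_mats:
  assumes "X \<in> mats R n"
  obtains k Y where "Y \<in> mats (S k) n" "X = map_mat (\<rho> k) Y"
  using mats_from_level[OF incseq_levels _ assms] by (auto simp: carrier_limit)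

lemma pos_limit: "pos R n = (\<Union>k. map_mat (\<rho> k) ` pos (S k) n)"
  by (simp add: direct_limit_def)

lemma level_pos: "X \<in> pos (S k) n \<Longrightarrow> map_mat (\<rho> k) X \<in> pos R n"
  by (auto simp: pos_limit)

text \<open>The key to the order on the union: passing to the limit creates no new positive matrices
  over a level. A positive representative at level \<open>j\<close> is compared with
  \<open>X\<close> at level \<open>k + j\<close>, and the transition from \<open>k\<close> reflects
  positivity.\<close>

lemma pos_limit_iff:
  assumes n: "n \<ge> 1" and X: "X \<in> mats (S k) n"
  shows "map_mat (\<rho> k) X \<in> pos R n \<longleftrightarrow> X \<in> pos (S k) n"
proof
  assume "map_mat (\<rho> k) X \<in> pos R n"
  then obtain j Y where Y: "Y \<in> pos (S j) n" and eq: "map_mat (\<rho> k) X = map_mat (\<rho> j) Y"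
    by (auto simp: pos_limit)
  interpret Sj: operator_system "S j" by (rule opsys)
  have Ym: "Y \<in> mats (S j) n" using Sj.pos_mats[OF n Y] .
  have "map_mat (transition f k j) X = map_mat (transition f j k) Y"
  proof (rule eq_matI)
    fix i l assume il: "i < dim_row (map_mat (transition f j k) Y)" "l < dim_col (map_mat (transition f j k) Y)"
    then have "map_mat (\<rho> k) X $$ (i, l) = map_mat (\<rho> j) Y $$ (i, l)" using eq by simp
    then show "map_mat (transition f k j) X $$ (i, l) = map_mat (transition f j k) Y $$ (i, l)"
      using il X Ym by (auto simp: mats_def intro!: transition_eq)
  qed (use X Ym in \<open>auto simp: mats_def\<close>)
  then have "map_mat (transition f k j) X \<in> pos (S (k + j)) n"
    using transition_embedding(3)[OF n Ym, of k] Y by (simp add: add.commute)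
  then show "X \<in> pos (S k) n"
    using transition_embedding(3)[OF n X] by simp
qed (auto simp: pos_limit)

section \<open>The union is an operator system\<close>

lemma vectorspace_limit: "vectorspace (class_ring :: complex ring) R"
proof -
  interpret S0: operator_system "S 0" by (rule opsys)
  \<comment> \<open>Each vector space axiom involves at most three vectors. These have
    representatives at one common level, where the axiom holds.\<close>
  have "Module.module (class_ring :: complex ring) R"
  proof (rule module_criteria)
    show "cring (class_ring :: complex ring)"
      by (rule module.axioms(1)[OF vectorspace.axioms(1)[OF S0.vectorspace_axioms]])
    show "\<zero>\<^bsub>R\<^esub> \<in> carrier R"
      using level_closed[OF zero_closed] zero_limit by simp
    show "\<forall>v w. v \<in> carrier R \<and> w \<in> carrier R \<longrightarrow> v \<oplus>\<^bsub>R\<^esub> w \<in> carrier R"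
      by (intro allI impI, elim conjE, erule (1) from_level2)
        (simp add: add_limit level_closed add_closed)
    show "\<forall>c v. c \<in> carrier class_ring \<and> v \<in> carrier R \<longrightarrow> c \<odot>\<^bsub>R\<^esub> v \<in> carrier R"
      by (intro allI impI, elim conjE, erule from_level1)
        (simp add: smult_limit level_closed smult_closed)
    show "\<forall>v\<in>carrier R. \<exists>neg_v\<in>carrier R. v \<oplus>\<^bsub>R\<^esub> neg_v = \<zero>\<^bsub>R\<^esub>"
    proof
      fix v assume "v \<in> carrier R"
      then obtain k a where a: "a \<in> carrier (S k)" "v = \<rho> k a" by (rule from_level1)
      interpret S: operator_system "S k" by (rule opsys)
      have "v \<oplus>\<^bsub>R\<^esub> \<rho> k (\<ominus>\<^bsub>S k\<^esub> a) = \<zero>\<^bsub>R\<^esub>"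
        using a by (simp add: add_limit S.M.r_neg zero_limit)
      then show "\<exists>neg_v\<in>carrier R. v \<oplus>\<^bsub>R\<^esub> neg_v = \<zero>\<^bsub>R\<^esub>"
        using a level_closed[of "\<ominus>\<^bsub>S k\<^esub> a" k] by auto
    qed
    show "\<forall>v w. v \<in> carrier R \<and> w \<in> carrier R \<longrightarrow> v \<oplus>\<^bsub>R\<^esub> w = w \<oplus>\<^bsub>R\<^esub> v"
    proof (intro allI impI, elim conjE)
      fix v w assume "v \<in> carrier R" "w \<in> carrier R"
      then obtain k a b where rep: "a \<in> carrier (S k)" "v = \<rho> k a" "b \<in> carrier (S k)" "w = \<rho> k b"
        by (rule from_level2)
      interpret S: operator_system "S k" by (rule opsys)
      show "v \<oplus>\<^bsub>R\<^esub> w = w \<oplus>\<^bsub>R\<^esub> v"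
        using rep by (simp add: add_limit S.M.a_comm)
    qed
    show "\<forall>v w x. v \<in> carrier R \<and> w \<in> carrier R \<and> x \<in> carrier R \<longrightarrow>
        v \<oplus>\<^bsub>R\<^esub> w \<oplus>\<^bsub>R\<^esub> x = v \<oplus>\<^bsub>R\<^esub> (w \<oplus>\<^bsub>R\<^esub> x)"
    proof (intro allI impI, elim conjE)
      fix v w x assume "v \<in> carrier R" "w \<in> carrier R" "x \<in> carrier R"
      then obtain k a b c where rep: "a \<in> carrier (S k)" "v = \<rho> k a" "b \<in> carrier (S k)" "w = \<rho> k b"
        "c \<in> carrier (S k)" "x = \<rho> k c"
        by (rule from_level3)
      interpret S: operator_system "S k" by (rule opsys)
      show "v \<oplus>\<^bsub>R\<^esub> w \<oplus>\<^bsub>R\<^esub> x = v \<oplus>\<^bsub>R\<^esub> (w \<oplus>\<^bsub>R\<^esub> x)"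
        using rep by (simp add: add_limit S.M.a_assoc)
    qed
    show "\<forall>v\<in>carrier R. v \<oplus>\<^bsub>R\<^esub> \<zero>\<^bsub>R\<^esub> = v"
    proof
      fix v assume "v \<in> carrier R"
      then obtain k a where a: "a \<in> carrier (S k)" "v = \<rho> k a" by (rule from_level1)
      interpret S: operator_system "S k" by (rule opsys)
      show "v \<oplus>\<^bsub>R\<^esub> \<zero>\<^bsub>R\<^esub> = v"
        using a add_limit[OF a(1) zero_closed] by (simp add: zero_limit)
    qed
    show "\<forall>a b v. a \<in> carrier class_ring \<and> b \<in> carrier class_ring \<and> v \<in> carrier R \<longrightarrow>
       a \<otimes>\<^bsub>class_ring\<^esub> b \<odot>\<^bsub>R\<^esub> v = a \<odot>\<^bsub>R\<^esub> (b \<odot>\<^bsub>R\<^esub> v)"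
    proof (intro allI impI, elim conjE)
      fix c d :: complex and v assume "v \<in> carrier R"
      then obtain k a where rep: "a \<in> carrier (S k)" "v = \<rho> k a" by (rule from_level1)
      interpret S: operator_system "S k" by (rule opsys)
      show "c \<otimes>\<^bsub>class_ring\<^esub> d \<odot>\<^bsub>R\<^esub> v = c \<odot>\<^bsub>R\<^esub> (d \<odot>\<^bsub>R\<^esub> v)"
        using rep by (simp add: smult_limit S.scale_scale S.scale_closed)
    qed
    show "\<forall>v\<in>carrier R. \<one>\<^bsub>class_ring\<^esub> \<odot>\<^bsub>R\<^esub> v = v"
    proof
      fix v assume "v \<in> carrier R"
      then obtain k a where rep: "a \<in> carrier (S k)" "v = \<rho> k a" by (rule from_level1)
      interpret S: operator_system "S k" by (rule opsys)
      show "\<one>\<^bsub>class_ring\<^esub> \<odot>\<^bsub>R\<^esub> v = v"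
        using rep by (simp add: smult_limit S.scale_one)
    qed
    show "\<forall>a b v. a \<in> carrier class_ring \<and> b \<in> carrier class_ring \<and> v \<in> carrier R \<longrightarrow>
       (a \<oplus>\<^bsub>class_ring\<^esub> b) \<odot>\<^bsub>R\<^esub> v = a \<odot>\<^bsub>R\<^esub> v \<oplus>\<^bsub>R\<^esub> b \<odot>\<^bsub>R\<^esub> v"
    proof (intro allI impI, elim conjE)
      fix c d :: complex and v assume "v \<in> carrier R"
      then obtain k a where rep: "a \<in> carrier (S k)" "v = \<rho> k a" by (rule from_level1)
      interpret S: operator_system "S k" by (rule opsys)
      show "(c \<oplus>\<^bsub>class_ring\<^esub> d) \<odot>\<^bsub>R\<^esub> v = c \<odot>\<^bsub>R\<^esub> v \<oplus>\<^bsub>R\<^esub> d \<odot>\<^bsub>R\<^esub> v"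
        using rep by (simp add: smult_limit add_limit S.scale_add_left S.scale_closed)
    qed
    show "\<forall>a v w. a \<in> carrier class_ring \<and> v \<in> carrier R \<and> w \<in> carrier R \<longrightarrow>
       a \<odot>\<^bsub>R\<^esub> (v \<oplus>\<^bsub>R\<^esub> w) = a \<odot>\<^bsub>R\<^esub> v \<oplus>\<^bsub>R\<^esub> a \<odot>\<^bsub>R\<^esub> w"
    proof (intro allI impI, elim conjE)
      fix c :: complex and v w assume "v \<in> carrier R" "w \<in> carrier R"
      then obtain k a b where rep: "a \<in> carrier (S k)" "v = \<rho> k a" "b \<in> carrier (S k)" "w = \<rho> k b"
        by (rule from_level2)
      interpret S: operator_system "S k" by (rule opsys)
      show "c \<odot>\<^bsub>R\<^esub> (v \<oplus>\<^bsub>R\<^esub> w) = c \<odot>\<^bsub>R\<^esub> v \<oplus>\<^bsub>R\<^esub> c \<odot>\<^bsub>R\<^esub> w"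
        using rep by (simp add: smult_limit add_limit S.scale_add_right S.scale_closed)
    qed
  qed
  \<comment> \<open>The remaining axiom concerns only the scalar field and is taken over from level
    0.\<close>
  then show ?thesis
    by (rule vectorspace.intro) (rule vectorspace.axioms(2)[OF S0.vectorspace_axioms])
qed

lemma star_limit: "star_vector_space R"
proof (rule star_vector_space.intro[OF vectorspace_limit], unfold_locales)
  show "adj R x \<in> carrier R" if "x \<in> carrier R" for x
    using that by (rule from_level1) (simp add: adj_limit level_closed adj_closed)
  show "adj R (adj R x) = x" if "x \<in> carrier R" for x
    using that by (rule from_level1) (simp add: adj_limit adj_closed star_vector_space.adj_adj[OF star])
  show "adj R (x \<oplus>\<^bsub>R\<^esub> y) = adj R x \<oplus>\<^bsub>R\<^esub> adj R y" if "x \<in> carrier R" "y \<in> carrier R" for x y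
    using that by (rule from_level2)
      (simp add: adj_limit adj_closed add_limit add_closed star_vector_space.adj_add[OF star])
  show "adj R (c \<odot>\<^bsub>R\<^esub> x) = cnj c \<odot>\<^bsub>R\<^esub> adj R x" if "x \<in> carrier R" for x c
    using that by (rule from_level1)
      (simp add: adj_limit adj_closed smult_limit smult_closed star_vector_space.adj_smult[OF star])
qed

lemma level_linear: "\<rho> k \<in> linear_maps (S k) R"
  by (intro linear_mapsI) (simp_all add: level_closed add_limit smult_limit)

lemma herm_from_level:
  assumes "X \<in> herm R n"
  obtains k Y where "Y \<in> herm (S k) n" "X = map_mat (\<rho> k) Y"
proof -
  have Xm: "X \<in> mats R n" and X: "mats_adj R X = X" using assms by (auto simp: herm_def)
  obtain k Y where Y: "Y \<in> mats (S k) n" "X = map_mat (\<rho> k) Y"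
    using Xm by (rule from_level_mats)
  interpret S: operator_system "S k" by (rule opsys)
  \<comment> \<open>Self-adjointness descends to the representative because \<open>\<rho> k\<close>
    is injective.\<close>
  have "map_mat (\<rho> k) (mats_adj (S k) Y) = map_mat (\<rho> k) Y"
    using X Y map_mat_mats_adj[of "S k" "\<rho> k" R Y n] by (simp add: adj_limit)
  then have "mats_adj (S k) Y = Y"
    using map_mat_inj_on_mats[OF inj S.mats_adj_closed[OF Y(1)] Y(1)] by simp
  then show thesis using Y that by (auto simp: herm_def)
qed

lemma mats_zero_limit: "map_mat (\<rho> k) (mats_zero (S k) n) = mats_zero R n"
  by (rule map_mat_mats_zero) (rule zero_limit)

lemma mats_unit_limit: "map_mat (\<rho> k) (mats_unit (S k) n) = mats_unit R n"
  by (rule map_mat_mats_unit) (simp_all add: zero_limit unital_def unit_limit)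

lemmas mats_add_limit = map_mat_mats_add[OF level_linear]
lemmas mats_smult_limit = map_mat_mats_smult[OF level_linear]

lemma pos_from_level:
  assumes "X \<in> pos R n" "n \<ge> 1"
  obtains k Y where "Y \<in> pos (S k) n" "Y \<in> mats (S k) n" "X = map_mat (\<rho> k) Y"
proof -
  obtain k Y where Y: "Y \<in> pos (S k) n" "X = map_mat (\<rho> k) Y"
    using assms by (auto simp: pos_limit)
  interpret S: operator_system "S k" by (rule opsys)
  show thesis using that Y S.pos_mats[OF assms(2)] by blast
qed

lemma ordered_limit: "matrix_ordered_space R"
proof (rule matrix_ordered_space.intro[OF star_limit], unfold_locales)
  fix n m :: nat assume n: "n \<ge> 1"
  show "pos R n \<subseteq> herm R n"
  proof
    fix X assume "X \<in> pos R n"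
    then obtain k Y where Y: "Y \<in> pos (S k) n" "Y \<in> mats (S k) n" "X = map_mat (\<rho> k) Y"
      using n by (rule pos_from_level)
    interpret S: operator_system "S k" by (rule opsys)
    have "mats_adj (S k) Y = Y" using Y S.pos_herm[OF n] by (auto simp: herm_def)
    then have "mats_adj R X = X"
      using Y map_mat_mats_adj[of "S k" "\<rho> k" R Y n] by (simp add: adj_limit)
    moreover have "X \<in> mats R n" using Y mats_map[of "S k" "\<rho> k" R] level_closed by simp
    ultimately show "X \<in> herm R n" by (simp add: herm_def)
  qed
  show "mats_zero R n \<in> pos R n"
  proof -
    interpret S: operator_system "S 0" by (rule opsys)
    show ?thesis using level_pos[OF S.pos_zero[OF n]] by (simp add: mats_zero_limit)
  qed
  show "mats_add R X Y \<in> pos R n" if X: "X \<in> pos R n" and Y: "Y \<in> pos R n" for X Y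
  proof -
    obtain k X' where X': "X' \<in> pos (S k) n" "X' \<in> mats (S k) n" "X = map_mat (\<rho> k) X'"
      using X n by (rule pos_from_level)
    obtain j Y' where Y': "Y' \<in> pos (S j) n" "Y' \<in> mats (S j) n" "Y = map_mat (\<rho> j) Y'"
      using Y n by (rule pos_from_level)
    \<comment> \<open>The summands may come from different levels; both are moved to
      \<open>k + j\<close> and stay positive there.\<close>
    let ?X = "map_mat (transition f k j) X'" and ?Y = "map_mat (transition f j k) Y'"
    interpret S: operator_system "S (k + j)" by (rule opsys)
    have pos: "?X \<in> pos (S (k + j)) n" "?Y \<in> pos (S (k + j)) n"
      using X' Y' transition_embedding(3)[OF n X'(2), of j] transition_embedding(3)[OF n Y'(2), of k]
      by (simp_all add: add.commute)
    have "map_mat (\<rho> (k + j)) ?X = X"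
      unfolding X'(3) map_mat_comp
      by (rule map_mat_cong_mats[OF X'(2)]) (rule transition_compat)
    moreover have "map_mat (\<rho> (k + j)) ?Y = Y"
      unfolding Y'(3) map_mat_comp
      using transition_compat[of _ j k]
      by (intro map_mat_cong_mats[OF Y'(2)]) (simp add: add.commute)
    ultimately have "mats_add R X Y = map_mat (\<rho> (k + j)) (mats_add (S (k + j)) ?X ?Y)"
      using mats_add_limit[OF S.pos_mats[OF n pos(1)] S.pos_mats[OF n pos(2)]] by simp
    then show ?thesis
      using level_pos[OF S.pos_add[OF n pos]] by simp
  qed
  show "mats_smult R (complex_of_real r) X \<in> pos R n" if X: "X \<in> pos R n" and r: "r \<ge> 0" for X r
  proof -
    obtain k Y where Y: "Y \<in> pos (S k) n" "Y \<in> mats (S k) n" "X = map_mat (\<rho> k) Y"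
      using X n by (rule pos_from_level)
    interpret S: operator_system "S k" by (rule opsys)
    show ?thesis
      using level_pos[OF S.pos_smult[OF n Y(1) r]] by (simp add: Y(3) mats_smult_limit[OF Y(2)])
  qed
  show "X = mats_zero R n" if X: "X \<in> pos R n" and neg: "mats_smult R (- 1) X \<in> pos R n" for X
  proof -
    obtain k Y where Y: "Y \<in> pos (S k) n" "Y \<in> mats (S k) n" "X = map_mat (\<rho> k) Y"
      using X n by (rule pos_from_level)
    interpret S: operator_system "S k" by (rule opsys)
    \<comment> \<open>Positivity of the negative is witnessed at some level;
      \<open>pos_limit_iff\<close> brings it back to the level of \<open>Y\<close>, where the cone
      is proper.\<close>
    have "mats_smult (S k) (- 1) Y \<in> pos (S k) n"
      using neg pos_limit_iff[OF n S.mats_smult_closed[OF Y(2)]]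
      by (simp add: Y(3) mats_smult_limit[OF Y(2)])
    then have "Y = mats_zero (S k) n" using S.pos_proper[OF n Y(1)] by simp
    then show ?thesis using Y mats_zero_limit by simp
  qed
  show "mats_compress R A X \<in> pos R m"
    if m: "m \<ge> 1" and A: "A \<in> carrier_mat n m" and X: "X \<in> pos R n" for A X
  proof -
    obtain k Y where Y: "Y \<in> pos (S k) n" "Y \<in> mats (S k) n" "X = map_mat (\<rho> k) Y"
      using X n by (rule pos_from_level)
    interpret S: operator_system "S k" by (rule opsys)
    show ?thesis
      using level_pos[OF S.pos_compress[OF n m A Y(1)]]
      by (simp add: Y(3) map_mat_mats_compress[OF star star_limit level_linear Y(2) A])
  qed
qed

lemma limit: "operator_system R"
proof (rule operator_system.intro[OF ordered_limit], unfold_locales)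
  show "order_unit R \<in> carrier R"
    using level_closed[OF order_unit_closed] unit_limit by simp
  show "adj R (order_unit R) = order_unit R"
    using adj_limit[OF order_unit_closed, of 0] operator_system.order_unit_adj[OF opsys, of 0]
    by (simp add: unit_limit)
  fix n :: nat and X assume n: "n \<ge> 1" and "X \<in> herm R n"
  then obtain k Y where Y: "Y \<in> herm (S k) n" "X = map_mat (\<rho> k) Y"
    by (metis herm_from_level)
  then have Ym: "Y \<in> mats (S k) n" by (simp add: herm_def)
  interpret S: operator_system "S k" by (rule opsys)
  have unit: "mats_smult (S k) c (mats_unit (S k) n) \<in> mats (S k) n" for c
    by (intro S.mats_smult_closed S.mats_unit_closed)
  have shift: "map_mat (\<rho> k) (mats_add (S k) (mats_smult (S k) c (mats_unit (S k) n)) Z)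
      = mats_add R (mats_smult R c (mats_unit R n)) (map_mat (\<rho> k) Z)" if "Z \<in> mats (S k) n" for c Z
    using that by (simp add: mats_add_limit[OF unit] mats_smult_limit[OF S.mats_unit_closed] mats_unit_limit)
  obtain r :: real where r: "r > 0"
    "mats_add (S k) (mats_smult (S k) (complex_of_real r) (mats_unit (S k) n)) (mats_smult (S k) (- 1) Y) \<in> pos (S k) n"
    using S.matrix_order_unit[OF n Y(1)] by blast
  show "\<exists>r::real. r > 0 \<and>
      mats_add R (mats_smult R (complex_of_real r) (mats_unit R n)) (mats_smult R (- 1) X) \<in> pos R n"
    using level_pos[OF r(2)] r(1)
    by (auto simp: Y(2) shift[OF S.mats_smult_closed[OF Ym]] mats_smult_limit[OF Ym])
  assume arch: "\<And>r::real. r > 0 \<Longrightarrow> mats_add R (mats_smult R (complex_of_real r) (mats_unit R n)) X \<in> pos R n"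
  \<comment> \<open>The levels witnessing \<open>arch\<close> may depend on \<open>r\<close>. By
    \<open>pos_limit_iff\<close> all these perturbations are positive at the fixed level
    \<open>k\<close>, so the Archimedean property of \<open>S k\<close> applies.\<close>
  have "mats_add (S k) (mats_smult (S k) (complex_of_real r) (mats_unit (S k) n)) Y \<in> pos (S k) n"
    if "r > 0" for r :: real
    using arch[OF that] pos_limit_iff[OF n S.mats_add_closed[OF unit Ym]] by (simp add: Y(2) shift[OF Ym])
  then have "Y \<in> pos (S k) n" by (rule S.archimedean[OF n Y(1)])
  then show "X \<in> pos R n" unfolding Y(2) by (rule level_pos)
qed

lemma level_ucp: "ucp (S k) R (\<rho> k)"
  by (auto simp: ucp_def completely_positive_def unital_def level_linear unit_limit pos_limit)

lemma limit_compatible: "compatible_maps S f R \<rho>"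
  by (simp add: compatible_maps_def limit level_ucp compat)

text \<open>The existence half of the universal property of the union. Elements with equal labels
  have equal images under the \<open>g k\<close>, and positive matrices over the union come from a
  single level, where \<open>g k\<close> is completely positive.\<close>

lemma limit_factor:
  assumes "compatible_maps S f L g"
  obtains \<eta> where "ucp R L \<eta>" "\<And>k x. x \<in> carrier (S k) \<Longrightarrow> \<eta> (\<rho> k x) = g k x"
proof -
  have g: "ucp (S k) L (g k)" and g_compat: "x \<in> carrier (S k) \<Longrightarrow> g (Suc k) (f k x) = g k x" for k x
    using assms by (auto simp: compatible_maps_def)
  note gl = linear_mapsD[OF ucpD(1)[OF g]]
  have g_transition: "g (k + d) (transition f k d x) = g k x" if "x \<in> carrier (S k)" for k d x
    using that by (induction d) (simp_all add: g_compat transition_linear(1))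
  define \<eta> where "\<eta> y = (SOME z. \<exists>k. \<exists>x\<in>carrier (S k). y = \<rho> k x \<and> z = g k x)" for y
  have \<eta>: "\<eta> (\<rho> k x) = g k x" if x: "x \<in> carrier (S k)" for k x
  proof -
    have "g j y = g k x" if y: "y \<in> carrier (S j)" "\<rho> k x = \<rho> j y" for j y
      using transition_eq[OF x y] g_transition[OF x, of j] g_transition[OF y(1), of k]
      by (simp add: add.commute)
    note unique = this
    show ?thesis
      unfolding \<eta>_def by (rule some_equality) (use x in blast, use unique in metis)
  qed
  have "\<eta> \<in> linear_maps R L"
  proof (rule linear_mapsI)
    show "\<eta> x \<in> carrier L" if "x \<in> carrier R" for x
      using that by (rule from_level1) (simp add: \<eta> gl(1))
    show "\<eta> (x \<oplus>\<^bsub>R\<^esub> y) = \<eta> x \<oplus>\<^bsub>L\<^esub> \<eta> y" if "x \<in> carrier R" "y \<in> carrier R" for x y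
      using that by (rule from_level2) (simp add: \<eta> gl(2) add_limit add_closed)
    show "\<eta> (c \<odot>\<^bsub>R\<^esub> x) = c \<odot>\<^bsub>L\<^esub> \<eta> x" if "x \<in> carrier R" for c x
      using that by (rule from_level1) (simp add: \<eta> gl(3) smult_limit smult_closed)
  qed
  moreover have "map_mat \<eta> X \<in> pos L n" if n: "n \<ge> 1" and X: "X \<in> pos R n" for X n
  proof -
    obtain k Y where Y: "Y \<in> pos (S k) n" "Y \<in> mats (S k) n" "X = map_mat (\<rho> k) Y"
      using X n by (rule pos_from_level)
    then have "map_mat \<eta> X = map_mat (g k) Y"
      unfolding Y(3) map_mat_comp by (intro map_mat_cong_mats[OF Y(2)]) (rule \<eta>)
    then show ?thesis using ucpD(3)[OF g n Y(1)] by simp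
  qed
  moreover have "\<eta> (order_unit R) = order_unit L"
    using \<eta>[OF order_unit_closed, of 0] ucpD(2)[OF g, of 0] by (simp add: unit_limit)
  ultimately have "ucp R L \<eta>"
    by (simp add: ucp_def completely_positive_def unital_def)
  then show thesis using that \<eta> by blast
qed

end

text \<open>\<open>L\<close> is known only through its universal property. Maps \<theta> from
  \<open>L\<close> to the concrete union and \<eta> back transfer both properties from the union to
  \<open>L\<close>.\<close>

lemma inductive_limit_embedding:
  fixes S :: "nat \<Rightarrow> 'a opsys" and L :: "'a opsys"
  assumes sys: "inductive_system S f"
    and emb: "\<And>k. complete_order_embedding (S k) (S (Suc k)) (f k)"
    and lim: "inductive_limit S f L g"
  shows "carrier L = (\<Union>k. g k ` carrier (S k))" "complete_order_embedding (S k) L (g k)"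
proof -
  have opsys: "operator_system (S k)" for k using sys by (simp add: inductive_system_def)
  have star: "star_vector_space (S k)" for k
    using opsys[of k] by (simp add: operator_system_def matrix_ordered_space_def)
  have inj: "inj_on (f k) (carrier (S k))" for k
    using complete_order_embeddingD(2)[OF opsys opsys emb] .
  \<comment> \<open>On a finite type all carriers are zero and a constant family will do; otherwise
    the labelling applies.\<close>
  have "\<exists>\<rho> :: nat \<Rightarrow> 'a \<Rightarrow> 'a. \<forall>k. inj_on (\<rho> k) (carrier (S k)) \<and>
      (\<forall>x\<in>carrier (S k). \<rho> (Suc k) (f k x) = \<rho> k x)"
  proof (cases "finite (UNIV :: 'a set)")
    case True
    then have "carrier (S k) = {\<zero>\<^bsub>S k\<^esub>}" for k
      using star_vector_space.finite_type_trivial[OF star] by blast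
    then show ?thesis by (intro exI[of _ "\<lambda>_ _. undefined"]) (simp add: inj_on_def)
  next
    case False
    then show ?thesis using injective_cocone_exists[of f "\<lambda>k. carrier (S k)"] inj by blast
  qed
  then obtain \<rho> :: "nat \<Rightarrow> 'a \<Rightarrow> 'a" where "\<And>k. inj_on (\<rho> k) (carrier (S k))"
    "\<And>k x. x \<in> carrier (S k) \<Longrightarrow> \<rho> (Suc k) (f k x) = \<rho> k x" by blast
  then interpret injective_cocone S f \<rho>
    using sys emb by unfold_locales
  have L: "compatible_maps S f L g" and univ: "\<And>(R :: 'a opsys) \<rho>. compatible_maps S f R \<rho> \<Longrightarrow>
        \<exists>\<theta>. ucp L R \<theta> \<and> (\<forall>k. \<forall>x\<in>carrier (S k). \<theta> (g k x) = \<rho> k x) \<and>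
           (\<forall>\<theta>'. ucp L R \<theta>' \<and> (\<forall>k. \<forall>x\<in>carrier (S k). \<theta>' (g k x) = \<rho> k x) \<longrightarrow>
              (\<forall>y\<in>carrier L. \<theta>' y = \<theta> y))"
    using lim unfolding inductive_limit_def by blast+
  have opL: "operator_system L" and g: "\<And>k. ucp (S k) L (g k)"
    using L by (auto simp: compatible_maps_def)
  note gl = linear_mapsD[OF ucpD(1)[OF g]]
  \<comment> \<open>The labels place the union on the type \<open>'a\<close>, so it is an admissible
    test object for \<open>L\<close>.\<close>
  obtain \<theta> where \<theta>: "ucp L R \<theta>" "\<And>k x. x \<in> carrier (S k) \<Longrightarrow> \<theta> (g k x) = \<rho> k x"
    using univ[OF limit_compatible] by blast
  obtain \<eta> where \<eta>: "ucp R L \<eta>" "\<And>k x. x \<in> carrier (S k) \<Longrightarrow> \<eta> (\<rho> k x) = g k x"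
    using limit_factor[OF L] by blast
  \<comment> \<open>Both \<eta> after \<theta> and the identity are unital completely positive maps
    from \<open>L\<close> to \<open>L\<close> that fix every \<open>g k x\<close>, so the uniqueness
    clause identifies them.\<close>
  have retract: "\<eta> (\<theta> y) = y" if y: "y \<in> carrier L" for y
  proof -
    obtain \<kappa> where "\<And>\<theta>'. ucp L L \<theta>' \<Longrightarrow> (\<And>k x. x \<in> carrier (S k) \<Longrightarrow> \<theta>' (g k x) = g k x)
        \<Longrightarrow> \<theta>' y = \<kappa> y"
      using univ[OF L] y by blast
    from this[of "\<lambda>y. \<eta> (\<theta> y)"] this[of "\<lambda>y. y"] show ?thesis
      using ucp_comp[OF \<theta>(1) \<eta>(1)] ucp_ident[of L] \<theta>(2) \<eta>(2) by simp
  qed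
  show "carrier L = (\<Union>k. g k ` carrier (S k))"
  proof (intro equalityI subsetI)
    fix y assume y: "y \<in> carrier L"
    then obtain k x where x: "x \<in> carrier (S k)" "\<theta> y = \<rho> k x"
      using from_level1 linear_mapsD(1)[OF ucpD(1)[OF \<theta>(1)]] by metis
    then have "y = g k x" using retract[OF y] \<eta>(2) by simp
    then show "y \<in> (\<Union>k. g k ` carrier (S k))" using x by blast
  qed (use gl(1) in auto)
  \<comment> \<open>Since \<theta> sends \<open>g k x\<close> to \<open>\<rho> k x\<close>,
    injectivity and reflection of positivity pass from \<open>\<rho> k\<close> to
    \<open>g k\<close>.\<close>
  have "inj_on (g k) (carrier (S k))"
  proof (rule inj_onI)
    fix x y assume xy: "x \<in> carrier (S k)" "y \<in> carrier (S k)" "g k x = g k y"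
    then have "\<rho> k x = \<rho> k y" using \<theta>(2) by metis
    then show "x = y" using inj_onD[OF injective_cocone.inj[OF injective_cocone_axioms]] xy by blast
  qed
  moreover have "map_mat (g k) X \<in> pos L n \<longleftrightarrow> X \<in> pos (S k) n" if n: "n \<ge> 1" and X: "X \<in> mats (S k) n" for n X
  proof
    assume "map_mat (g k) X \<in> pos L n"
    then have "map_mat \<theta> (map_mat (g k) X) \<in> pos R n" by (rule ucpD(3)[OF \<theta>(1) n])
    moreover have "map_mat \<theta> (map_mat (g k) X) = map_mat (\<rho> k) X"
      unfolding map_mat_comp by (rule map_mat_cong_mats[OF X]) (rule \<theta>(2))
    ultimately show "X \<in> pos (S k) n" using pos_limit_iff[OF n X] by simp
  qed (rule ucpD(3)[OF g n])
  ultimately show "complete_order_embedding (S k) L (g k)"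
    using ucpD(1)[OF g] by (simp add: complete_order_embedding_iff[OF opsys opL])
qed

subsection \<open>Tensor products of linear maps\<close>

text \<open>Ensures that \<open>tensor_map\<close> evaluates a tensor at a genuine bilinear form,
  where the default value 0 in \<open>tensor\<close> does not intervene.\<close>

lemma bilinear_forms_pullback:
  assumes "B \<in> bilinear_forms S' T'" "f \<in> linear_maps S S'" "g \<in> linear_maps T T'"
  shows "(\<lambda>s t. B (f s) (g t)) \<in> bilinear_forms S T"
  using assms(1) linear_mapsD[OF assms(2)] linear_mapsD[OF assms(3)]
  by (simp add: bilinear_forms_def)

lemma tensor_map_sum:
  assumes "f \<in> linear_maps S S'" "g \<in> linear_maps T T'"
  shows "tensor_map S' T' f g (\<lambda>B. \<Sum>i<(n::nat). tensor S T (s i) (t i) B) =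
    (\<lambda>B. \<Sum>i<n. tensor S' T' (f (s i)) (g (t i)) B)"
proof
  show "tensor_map S' T' f g (\<lambda>B. \<Sum>i<(n::nat). tensor S T (s i) (t i) B) B =
      (\<Sum>i<n. tensor S' T' (f (s i)) (g (t i)) B)" for B
    using bilinear_forms_pullback[OF _ assms, of B] by (simp add: tensor_map_def tensor_def)
qed

lemma tensor_carrierE:
  assumes "u \<in> tensor_carrier S T"
  obtains n s t where "u = (\<lambda>B. \<Sum>i<(n::nat). tensor S T (s i) (t i) B)"
    "\<forall>i<n. s i \<in> carrier S" "\<forall>i<n. t i \<in> carrier T"
  using assms unfolding tensor_carrier_def by auto

text \<open>Tensors are finite sums of elementary ones, so it suffices to compare the maps on left
  factors from the carrier.\<close>

lemma tensor_map_comp: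
  assumes f: "f \<in> linear_maps S S'" and g: "g \<in> linear_maps S' S''" and h: "h \<in> linear_maps S S''"
    and eq: "\<And>s. s \<in> carrier S \<Longrightarrow> g (f s) = h s" and u: "u \<in> tensor_carrier S T"
  shows "tensor_map S'' T g id (tensor_map S' T f id u) = tensor_map S'' T h id u"
proof -
  obtain n s t where nst: "u = (\<lambda>B. \<Sum>i<(n::nat). tensor S T (s i) (t i) B)"
    "\<forall>i<n. s i \<in> carrier S" "\<forall>i<n. t i \<in> carrier T"
    using u by (rule tensor_carrierE)
  have id: "id \<in> linear_maps T T" by (rule linear_mapsI) auto
  show ?thesis
    unfolding nst(1) tensor_map_sum[OF f id] tensor_map_sum[OF g id] tensor_map_sum[OF h id]
    using nst(2) eq by simp
qed

text \<open>A tensor has finitely many left factors, and these lie in the range of a single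
  \<open>g k\<close>; the right factors are kept.\<close>

lemma tensor_carrier_from_level:
  assumes lin: "\<And>k. g k \<in> linear_maps (S k) L"
    and inc: "incseq (\<lambda>k. g k ` carrier (S k))" and cover: "carrier L = (\<Union>k. g k ` carrier (S k))"
    and u: "u \<in> tensor_carrier L T"
  shows "\<exists>k. \<exists>v\<in>tensor_carrier (S k) T. u = tensor_map L T (g k) id v"
proof -
  obtain n s t where nst: "u = (\<lambda>B. \<Sum>i<(n::nat). tensor L T (s i) (t i) B)"
    "\<forall>i<n. s i \<in> carrier L" "\<forall>i<n. t i \<in> carrier T"
    using u by (rule tensor_carrierE)
  have "s ` {..<n} \<subseteq> (\<Union>k. g k ` carrier (S k))" using nst(2) cover by auto
  then obtain k where k: "s ` {..<n} \<subseteq> g k ` carrier (S k)"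
    using finite_subset_incseq[OF inc, of "s ` {..<n}"] by auto
  define s' where "s' i = inv_into (carrier (S k)) (g k) (s i)" for i
  have s': "s' i \<in> carrier (S k)" "g k (s' i) = s i" if "i < n" for i
    using k that unfolding s'_def by (auto intro!: inv_into_into f_inv_into_f)
  have id: "id \<in> linear_maps T T" by (rule linear_mapsI) auto
  have "(\<lambda>B. \<Sum>i<n. tensor (S k) T (s' i) (t i) B) \<in> tensor_carrier (S k) T"
    using s'(1) nst(3) unfolding tensor_carrier_def by blast
  moreover have "u = tensor_map L T (g k) id (\<lambda>B. \<Sum>i<n. tensor (S k) T (s' i) (t i) B)"
    unfolding nst(1) tensor_map_sum[OF lin id] using s'(2) by simp
  ultimately show ?thesis by blast
qed

lemma carrier_tensor_opsys: "carrier (tensor_opsys S T P) = tensor_carrier S T"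
  by (simp add: tensor_opsys_def)

section \<open>Comparison of two cocones over the same system\<close>

lemma inductive_limit_compatible:
  "inductive_limit S f L g \<Longrightarrow> compatible_maps S f L g"
  by (simp add: inductive_limit_def)

lemma compatible_maps_incseq:
  assumes "inductive_system S f" "compatible_maps S f L g"
  shows "incseq (\<lambda>k. g k ` carrier (S k))"
proof (rule cocone_incseq)
  show "f k x \<in> carrier (S (Suc k))" if "x \<in> carrier (S k)" for k x
    using assms(1) by (intro linear_mapsD(1)[OF ucpD(1) that]) (simp add: inductive_system_def)
  show "g (Suc k) (f k x) = g k x" if "x \<in> carrier (S k)" for k x
    using assms(2) that by (simp add: compatible_maps_def)
qed

text \<open>Covering makes \<theta> onto, and injectivity of the \<open>z k\<close> makes it
  injective. Its inverse is completely positive because positive matrices over \<open>Z\<close> come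
  from positive matrices at a level.\<close>

lemma covering_embeddings_iso:
  assumes sys: "inductive_system X f" and W: "compatible_maps X f W w" and Z: "compatible_maps X f Z z"
    and cover_W: "carrier W = (\<Union>k. w k ` carrier (X k))"
    and cover_Z: "carrier Z = (\<Union>k. z k ` carrier (X k))"
    and emb: "\<And>k. complete_order_embedding (X k) Z (z k)"
    and \<theta>: "ucp W Z \<theta>" "\<And>k x. x \<in> carrier (X k) \<Longrightarrow> \<theta> (w k x) = z k x"
  shows "\<exists>\<alpha>. unital Z W \<alpha> \<and> complete_order_iso Z W \<alpha> \<and> (\<forall>k. \<forall>x\<in>carrier (X k). \<alpha> (z k x) = w k x)"
proof -
  have opX: "\<And>k. operator_system (X k)" and opW: "operator_system W" and opZ: "operator_system Z"
    and w: "\<And>k. ucp (X k) W (w k)" and z: "\<And>k. ucp (X k) Z (z k)"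
    using sys W Z by (auto simp: inductive_system_def compatible_maps_def)
  interpret W: operator_system W by fact
  interpret Z: operator_system Z by fact
  note \<theta>l = linear_mapsD[OF ucpD(1)[OF \<theta>(1)]]
  note wl = linear_mapsD[OF ucpD(1)[OF w]]
  note incW = compatible_maps_incseq[OF sys W]
  \<comment> \<open>Two elements of \<open>W\<close> have preimages at one level, and there \<theta>
    turns \<open>w k\<close> into the injective \<open>z k\<close>.\<close>
  have "inj_on \<theta> (carrier W)"
  proof (rule inj_onI)
    fix x y assume xy: "x \<in> carrier W" "y \<in> carrier W" "\<theta> x = \<theta> y"
    then obtain k where "{x, y} \<subseteq> w k ` carrier (X k)"
      using finite_subset_incseq[OF incW, of "{x, y}"] cover_W by auto
    then obtain a b where ab: "a \<in> carrier (X k)" "x = w k a" "b \<in> carrier (X k)" "y = w k b"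
      by auto
    then have "z k a = z k b" using xy(3) \<theta>(2) by simp
    then show "x = y" using complete_order_embeddingD(2)[OF opX opZ emb] ab by (auto dest: inj_onD)
  qed
  moreover have "\<theta> ` carrier W = carrier Z"
    unfolding cover_W cover_Z image_UN image_image using \<theta>(2) by simp
  ultimately have bij: "bij_betw \<theta> (carrier W) (carrier Z)" by (simp add: bij_betw_def)
  define \<alpha> where "\<alpha> = inv_into (carrier W) \<theta>"
  have bij': "bij_betw \<alpha> (carrier Z) (carrier W)"
    unfolding \<alpha>_def by (rule bij_betw_inv_into[OF bij])
  have \<alpha>\<theta>: "\<alpha> (\<theta> x) = x" if "x \<in> carrier W" for x
    using that bij by (simp add: \<alpha>_def bij_betw_inv_into_left)
  have \<theta>\<alpha>: "\<theta> (\<alpha> y) = y" and \<alpha>_closed: "\<alpha> y \<in> carrier W" if "y \<in> carrier Z" for y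
    using that bij bij' by (auto simp: \<alpha>_def bij_betw_inv_into_right bij_betw_apply)
  have \<alpha>z: "\<alpha> (z k x) = w k x" if "x \<in> carrier (X k)" for k x
    using \<alpha>\<theta>[OF wl(1)[OF that]] \<theta>(2)[OF that] by simp
  have lin: "\<alpha> \<in> linear_maps Z W"
  proof (rule linear_mapsI)
    fix x y assume xy: "x \<in> carrier Z" "y \<in> carrier Z"
    have "\<theta> (\<alpha> x \<oplus>\<^bsub>W\<^esub> \<alpha> y) = x \<oplus>\<^bsub>Z\<^esub> y" using xy by (simp add: \<theta>l \<theta>\<alpha> \<alpha>_closed)
    then show "\<alpha> (x \<oplus>\<^bsub>Z\<^esub> y) = \<alpha> x \<oplus>\<^bsub>W\<^esub> \<alpha> y"
      using \<alpha>\<theta>[of "\<alpha> x \<oplus>\<^bsub>W\<^esub> \<alpha> y"] xy \<alpha>_closed by simp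
  next
    fix c x assume x: "x \<in> carrier Z"
    have "\<theta> (c \<odot>\<^bsub>W\<^esub> \<alpha> x) = c \<odot>\<^bsub>Z\<^esub> x" using x by (simp add: \<theta>l \<theta>\<alpha> \<alpha>_closed)
    then show "\<alpha> (c \<odot>\<^bsub>Z\<^esub> x) = c \<odot>\<^bsub>W\<^esub> \<alpha> x"
      using \<alpha>\<theta>[of "c \<odot>\<^bsub>W\<^esub> \<alpha> x"] x \<alpha>_closed W.scale_closed by simp
  qed (rule \<alpha>_closed)
  \<comment> \<open>A representative of a positive matrix over \<open>Z\<close> is itself positive,
    since \<open>z k\<close> reflects positivity; \<open>w k\<close> then carries it into the cone
    of \<open>W\<close>.\<close>
  have cp: "completely_positive Z W \<alpha>"
    unfolding completely_positive_def
  proof (intro conjI allI ballI impI lin)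
    fix n :: nat and Y assume n: "n \<ge> 1" and Y: "Y \<in> pos Z n"
    obtain k V where V: "V \<in> mats (X k) n" "Y = map_mat (z k) V"
      using mats_from_level[OF compatible_maps_incseq[OF sys Z] _ Z.pos_mats[OF n Y]] cover_Z by auto
    then have "V \<in> pos (X k) n"
      using complete_order_embeddingD(3)[OF opX opZ emb n V(1)] Y by simp
    moreover have "map_mat \<alpha> Y = map_mat (w k) V"
      unfolding V(2) map_mat_comp by (rule map_mat_cong_mats[OF V(1)]) (rule \<alpha>z)
    ultimately show "map_mat \<alpha> Y \<in> pos W n"
      using ucpD(3)[OF w n] by simp
  qed
  \<comment> \<open>The double \<open>inv_into\<close> is identified with \<theta> on the carrier,
    which suffices for matrices over \<open>W\<close>.\<close>
  have inverse: "inv_into (carrier Z) \<alpha> x = \<theta> x" if "x \<in> carrier W" for x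
    using that bij by (simp add: \<alpha>_def inv_into_inv_into_eq)
  have "completely_positive W Z (inv_into (carrier Z) \<alpha>)"
    unfolding completely_positive_def
  proof (intro conjI allI ballI impI)
    show "inv_into (carrier Z) \<alpha> \<in> linear_maps W Z"
      by (rule linear_mapsI) (simp_all add: inverse \<theta>l W.scale_closed)
    fix n :: nat and Y assume n: "n \<ge> 1" and Y: "Y \<in> pos W n"
    have "map_mat (inv_into (carrier Z) \<alpha>) Y = map_mat \<theta> Y"
      by (rule map_mat_cong_mats[OF W.pos_mats[OF n Y]]) (rule inverse)
    then show "map_mat (inv_into (carrier Z) \<alpha>) Y \<in> pos Z n"
      using ucpD(3)[OF \<theta>(1) n Y] by simp
  qed
  then have "complete_order_iso Z W \<alpha>"
    using bij' cp by (simp add: complete_order_iso_def)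
  moreover have "unital Z W \<alpha>"
    using \<alpha>\<theta>[OF W.order_unit_closed] ucpD(2)[OF \<theta>(1)] by (simp add: unital_def)
  ultimately show ?thesis using \<alpha>z by blast
qed

section \<open>Tensoring with a fixed operator system and passing to the limit\<close>

theorem theorem4p33:
  fixes S :: "nat \<Rightarrow> 'a opsys" and \<phi> :: "nat \<Rightarrow> 'a \<Rightarrow> 'a"
    and L :: "'a opsys" and \<phi>_inf :: "nat \<Rightarrow> 'a \<Rightarrow> 'a"
    and T :: "'a opsys" and \<mu> :: "'a tensor_cones"
    and W :: "('a, 'a) tensor opsys"
    and \<psi>_inf :: "nat \<Rightarrow> ('a, 'a) tensor \<Rightarrow> ('a, 'a) tensor"
  assumes "inductive_system S \<phi>"
    and "\<And>k. complete_order_embedding (S k) (S (Suc k)) (\<phi> k)"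
    and "inductive_limit S \<phi> L \<phi>_inf"
    and "operator_system T"
    and "operator_system_tensor_product \<mu>"
    and "functorial_tensor_product \<mu>"
    and "injective_tensor_product \<mu>"
    and "inductive_limit (\<lambda>k. S k \<otimes>[\<mu>] T) (\<lambda>k. tensor_map (S (Suc k)) T (\<phi> k) id) W \<psi>_inf"
  shows "\<exists>\<alpha>. \<alpha> \<in> linear_maps (L \<otimes>[\<mu>] T) W \<and>
      (\<forall>k. \<forall>u\<in>carrier (S k \<otimes>[\<mu>] T). \<alpha> (tensor_map L T (\<phi>_inf k) id u) = \<psi>_inf k u) \<and>
      (\<forall>\<beta>. \<beta> \<in> linear_maps (L \<otimes>[\<mu>] T) W \<and>
         (\<forall>k. \<forall>u\<in>carrier (S k \<otimes>[\<mu>] T). \<beta> (tensor_map L T (\<phi>_inf k) id u) = \<psi>_inf k u) \<longrightarrow>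
         (\<forall>u\<in>carrier (L \<otimes>[\<mu>] T). \<beta> u = \<alpha> u)) \<and>
      unital (L \<otimes>[\<mu>] T) W \<alpha> \<and> complete_order_iso (L \<otimes>[\<mu>] T) W \<alpha>"
proof -
  let ?X = "\<lambda>k. S k \<otimes>[\<mu>] T" and ?f = "\<lambda>k. tensor_map (S (Suc k)) T (\<phi> k) id"
  let ?Z = "L \<otimes>[\<mu>] T" and ?z = "\<lambda>k. tensor_map L T (\<phi>_inf k) id"
  note T = \<open>operator_system T\<close>
  have opS: "operator_system (S k)" and \<phi>: "ucp (S k) (S (Suc k)) (\<phi> k)" for k
    using assms(1) by (auto simp: inductive_system_def)
  have L: "compatible_maps S \<phi> L \<phi>_inf" by (rule inductive_limit_compatible[OF assms(3)])
  then have opL: "operator_system L" and \<phi>_inf: "\<And>k. ucp (S k) L (\<phi>_inf k)"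
    and compat: "\<And>k x. x \<in> carrier (S k) \<Longrightarrow> \<phi>_inf (Suc k) (\<phi> k x) = \<phi>_inf k x"
    by (auto simp: compatible_maps_def)
  have op_tensor: "operator_system (A \<otimes>[\<mu>] T)" if "operator_system A" for A
    using assms(5) T that by (auto simp: operator_system_tensor_product_def tensor_structure_def)
  have id: "ucp T T id" "complete_order_embedding T T id"
    using ucp_ident[of T] complete_order_embedding_ident[OF T] by (simp_all add: id_def)
  have ucp_tensor: "ucp (A \<otimes>[\<mu>] T) (B \<otimes>[\<mu>] T) (tensor_map B T g id)"
    if "operator_system A" "operator_system B" "ucp A B g" for A B g
    using assms(6) T that id(1) unfolding functorial_tensor_product_def by blast
  \<comment> \<open>Injectivity of \<mu> enters here, with the identity of \<open>T\<close> as the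
    second embedding.\<close>
  have emb_tensor: "complete_order_embedding (A \<otimes>[\<mu>] T) (B \<otimes>[\<mu>] T) (tensor_map B T g id)"
    if "operator_system A" "operator_system B" "ucp A B g" "complete_order_embedding A B g" for A B g
    using assms(7) T that id unfolding injective_tensor_product_def ucp_def by blast
  have sysX: "inductive_system ?X ?f"
    using op_tensor opS ucp_tensor \<phi> by (simp add: inductive_system_def)
  have embX: "complete_order_embedding (?X k) (?X (Suc k)) (?f k)" for k
    by (rule emb_tensor[OF opS opS \<phi> assms(2)])
  have W: "compatible_maps ?X ?f W \<psi>_inf" by (rule inductive_limit_compatible[OF assms(8)])
  have "?z (Suc k) (?f k u) = ?z k u" if "u \<in> carrier (?X k)" for k u
    by (rule tensor_map_comp[OF ucpD(1)[OF \<phi>] ucpD(1)[OF \<phi>_inf] ucpD(1)[OF \<phi>_inf] compat])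
      (use that in \<open>simp_all add: carrier_tensor_opsys\<close>)
  then have Z: "compatible_maps ?X ?f ?Z ?z"
    using op_tensor[OF opL] ucp_tensor[OF opS opL \<phi>_inf] by (simp add: compatible_maps_def)
  \<comment> \<open>The tensored system again consists of embeddings, so the description of limits
    of embeddings applies to \<open>W\<close> itself.\<close>
  have coverW: "carrier W = (\<Union>k. \<psi>_inf k ` carrier (?X k))"
    by (rule inductive_limit_embedding(1)[OF sysX embX assms(8)])
  \<comment> \<open>The same description applied to \<open>L\<close> makes each
    \<open>\<phi>_inf k\<close> an embedding, and \<mu> preserves this.\<close>
  have embZ: "complete_order_embedding (?X k) ?Z (?z k)" for k
    by (rule emb_tensor[OF opS opL \<phi>_inf inductive_limit_embedding(2)[OF assms(1,2,3)]])
  have from_level: "\<exists>k. \<exists>v\<in>carrier (?X k). u = ?z k v" if "u \<in> carrier ?Z" for u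
    using tensor_carrier_from_level[OF ucpD(1)[OF \<phi>_inf] compatible_maps_incseq[OF assms(1) L]
        inductive_limit_embedding(1)[OF assms(1,2,3)]] that
    by (simp add: carrier_tensor_opsys)
  have coverZ: "carrier ?Z = (\<Union>k. ?z k ` carrier (?X k))"
  proof (intro equalityI subsetI)
    fix u assume "u \<in> (\<Union>k. ?z k ` carrier (?X k))"
    then show "u \<in> carrier ?Z"
      using linear_mapsD(1)[OF ucpD(1)[OF ucp_tensor[OF opS opL \<phi>_inf]]] by force
  next
    fix u assume "u \<in> carrier ?Z"
    from from_level[OF this] show "u \<in> (\<Union>k. ?z k ` carrier (?X k))" by force
  qed
  \<comment> \<open>\<open>?Z\<close> has the same element type as \<open>W\<close>, so it is a test
    object for the universal property of \<open>W\<close>.\<close>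
  obtain \<theta> where \<theta>: "ucp W ?Z \<theta>" "\<And>k x. x \<in> carrier (?X k) \<Longrightarrow> \<theta> (\<psi>_inf k x) = ?z k x"
    using assms(8) Z unfolding inductive_limit_def by blast
  have "\<exists>\<alpha>. unital ?Z W \<alpha> \<and> complete_order_iso ?Z W \<alpha> \<and>
      (\<forall>k. \<forall>u\<in>carrier (?X k). \<alpha> (?z k u) = \<psi>_inf k u)"
    by (rule covering_embeddings_iso) (fact sysX W Z coverW coverZ embZ \<theta>)+
  then obtain \<alpha> where \<alpha>: "unital ?Z W \<alpha>" "complete_order_iso ?Z W \<alpha>"
    "\<And>k u. u \<in> carrier (?X k) \<Longrightarrow> \<alpha> (?z k u) = \<psi>_inf k u"
    by blast
  \<comment> \<open>The ranges of the \<open>?z k\<close> cover \<open>?Z\<close>, so the prescribed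
    values determine the map.\<close>
  have unique: "\<beta> u = \<alpha> u" if \<beta>: "\<forall>k. \<forall>u\<in>carrier (?X k). \<beta> (?z k u) = \<psi>_inf k u" and u: "u \<in> carrier ?Z" for \<beta> u
  proof -
    obtain k v where "v \<in> carrier (?X k)" "u = ?z k v" using from_level[OF u] by blast
    then show ?thesis using \<beta> \<alpha>(3) by simp
  qed
  have lin: "\<alpha> \<in> linear_maps ?Z W"
    using \<alpha>(2) by (simp add: complete_order_iso_def completely_positive_def)
  show ?thesis
  proof (intro exI[of _ \<alpha>] conjI allI ballI impI)
    show "\<beta> u = \<alpha> u" if "\<beta> \<in> linear_maps ?Z W \<and>
      (\<forall>k. \<forall>u\<in>carrier (?X k). \<beta> (?z k u) = \<psi>_inf k u)" "u \<in> carrier ?Z" for \<beta> u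
      by (rule unique[OF conjunct2[OF that(1)] that(2)])
  qed (fact lin \<alpha>)+
qed

end
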